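(* Let $\Gamma\subset\mathbb{C}^N$ be a smooth submanifold of real dimension $d\le 2N$ and let $a\in L^\infty(\Gamma)$ have compact support. Then there exists $C>0$ such that for all $k>0$ the operator norm of $T_{a\,d\sigma}:\mathcal{B}_k\to\mathcal{B}_k$ satisfies $$\|T_{a\,d\sigma}\|\le C\,\|a\|_\infty\,k^{N-d/2}.$$
   Context: For $k>0$, $\mathcal{B}_k=\{\psi\in L^2(\mathbb{C}^N,dL):\psi(z)=f(z)e^{-k|z|^2/2},\ f \text{ entire holomorphic}\}$, where $dL$ is Lebesgue measure; it is a closed subspace of $L^2(\mathbb{C}^N,dL)$ with the $L^2$ norm. Its reproducing kernel is $\Pi_k(z,\overline w)=\left(\frac{k}{\pi}\right)^N e^{k z\overline w-k|z|^2/2-k|w|^2/2}$, where $z\overline w=\sum_{j=1}^N z_j\overline{w_j}$. $d\sigma$ is the measure on $\Gamma\subset\mathbb{C}^N\cong\mathbb{R}^{2N}$ induced by Lebesgue measure (the Riemannian volume measure of the induced Euclidean metric). The operator $T_{a\,d\sigma}$ is defined by $T_{a\,d\sigma}(\psi)(z)=\int_\Gamma \Pi_k(z,\overline w)\,\psi(w)\,a(w)\,d\sigma(w)$. *)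

theory Defs
  imports "HOL-Analysis.Analysis" "HOL-Probability.Essential_Supremum"
begin

primrec Ck_on :: "nat \<Rightarrow> 'a::euclidean_space set \<Rightarrow> ('a \<Rightarrow> 'b::real_normed_vector) \<Rightarrow> bool" where
  "Ck_on 0 S f \<longleftrightarrow> continuous_on S f"
| "Ck_on (Suc m) S f \<longleftrightarrow>
     (\<forall>x\<in>S. f differentiable (at x)) \<and> (\<forall>v. Ck_on m S (\<lambda>x. frechet_derivative f (at x) v))"

text \<open>Only meant for open \<open>S\<close>, since derivatives are taken in the full neighbourhood.\<close>

definition smooth_on :: "'a::euclidean_space set \<Rightarrow> ('a \<Rightarrow> 'b::real_normed_vector) \<Rightarrow> bool" where
  "smooth_on S f \<longleftrightarrow> (\<forall>m. Ck_on m S f)"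

text \<open>A slice chart of \<open>M\<close> is a diffeomorphism \<open>\<phi>\<close> between open subsets \<open>V\<close> and \<open>\<phi> ` V\<close> of the
  ambient space under which \<open>M\<close> corresponds to a coordinate \<open>d\<close>-plane \<open>span B\<close>.  The plane plays
  the role of \<open>\<real>\<^sup>d\<close>, so \<open>d\<close> can be any natural number, including \<open>0\<close>.\<close>

definition slice_chart ::
  "nat \<Rightarrow> 'a::euclidean_space set \<Rightarrow> 'a set \<Rightarrow> 'a set \<Rightarrow> ('a \<Rightarrow> 'a) \<Rightarrow> bool" where
  "slice_chart d M B V \<phi> \<longleftrightarrow>
     B \<subseteq> Basis \<and> card B = d \<and> open V \<and> open (\<phi> ` V) \<and>
     (\<exists>\<psi>. homeomorphism V (\<phi> ` V) \<phi> \<psi> \<and> smooth_on V \<phi> \<and> smooth_on (\<phi> ` V) \<psi>) \<and>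
     \<phi> ` (V \<inter> span B) = M \<inter> \<phi> ` V"

definition smooth_submanifold :: "nat \<Rightarrow> 'a::euclidean_space set \<Rightarrow> bool" where
  "smooth_submanifold d M \<longleftrightarrow> (\<forall>p\<in>M. \<exists>B V \<phi>. slice_chart d M B V \<phi> \<and> p \<in> \<phi> ` V)"

text \<open>Lebesgue measure on the coordinate plane \<open>span B\<close>, as a measure on the ambient space
  (for \<open>B = Basis\<close> it is \<^const>\<open>lborel\<close>, for \<open>B = {}\<close> the unit mass at the origin).\<close>

definition plane_lborel :: "'a::euclidean_space set \<Rightarrow> 'a measure" where
  "plane_lborel B = distr (\<Pi>\<^sub>M b\<in>B. (lborel :: real measure)) borel (\<lambda>x. \<Sum>b\<in>B. x b *\<^sub>R b)"

text \<open>Leibniz formula for the determinant of the Gram matrix of the vectors \<open>L b\<close>, \<open>b \<in> B\<close>.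
  With \<open>L\<close> the derivative of a slice chart this is \<open>det g\<close> for the induced Euclidean metric \<open>g\<close>.\<close>

definition gram_det :: "'a::euclidean_space set \<Rightarrow> ('a \<Rightarrow> 'a) \<Rightarrow> real" where
  "gram_det B L = (\<Sum>p\<in>{p. p permutes B}. of_int (sign p) * (\<Prod>b\<in>B. L b \<bullet> L (p b)))"

text \<open>The Riemannian volume measure of the metric induced on \<open>M\<close>: the Borel measure with density
  \<open>sqrt (det g)\<close> in every chart.  As \<open>M\<close> is covered by countably many charts, these conditions
  determine \<open>\<sigma>\<close> uniquely.\<close>

definition riemannian_volume :: "nat \<Rightarrow> 'a::euclidean_space set \<Rightarrow> 'a measure \<Rightarrow> bool" where
  "riemannian_volume d M \<sigma> \<longleftrightarrow>
     sets \<sigma> = sets (restrict_space borel M) \<and>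
     (\<forall>B V \<phi> A. slice_chart d M B V \<phi> \<longrightarrow> A \<in> sets borel \<longrightarrow> A \<subseteq> V \<inter> span B \<longrightarrow>
        emeasure \<sigma> (\<phi> ` A) =
          (\<integral>\<^sup>+x\<in>A. ennreal (sqrt (gram_det B (frechet_derivative \<phi> (at x)))) \<partial>plane_lborel B))"

definition Linf_norm :: "'a measure \<Rightarrow> ('a \<Rightarrow> complex) \<Rightarrow> ennreal" where
  "Linf_norm M a = esssup M (\<lambda>x. ennreal (cmod (a x)))"

definition Linf :: "'a measure \<Rightarrow> ('a \<Rightarrow> complex) set" where
  "Linf M = {a \<in> borel_measurable M. Linf_norm M a < \<infinity>}"

text \<open>Support of a class of functions modulo null sets: the complement in \<open>space M\<close> of the
  largest relatively open set on which \<open>a\<close> vanishes almost everywhere.\<close>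

definition ess_support :: "'a::topological_space measure \<Rightarrow> ('a \<Rightarrow> complex) \<Rightarrow> 'a set" where
  "ess_support M a =
     {x \<in> space M. \<forall>U. open U \<longrightarrow> x \<in> U \<longrightarrow> \<not> (AE y in M. y \<in> U \<longrightarrow> a y = 0)}"

definition entire :: "(complex ^ 'n \<Rightarrow> complex) \<Rightarrow> bool" where
  "entire f \<longleftrightarrow> (\<forall>z. \<exists>D. (f has_derivative D) (at z) \<and> (\<forall>c v. D (c *s v) = c * D v))"

text \<open>The condition \<open>\<psi> \<in> L\<^sup>2\<close> is square integrability alone, as \<open>\<psi>\<close> is continuous.\<close>

definition bargmann_space :: "real \<Rightarrow> (complex ^ 'n \<Rightarrow> complex) set" where
  "bargmann_space k =
     {\<psi>. (\<exists>f. entire f \<and> \<psi> = (\<lambda>z. f z * exp (complex_of_real (- k * (norm z)\<^sup>2 / 2)))) \<and>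
         integrable lborel (\<lambda>z. (cmod (\<psi> z))\<^sup>2)}"

definition L2_norm :: "(complex ^ 'n \<Rightarrow> complex) \<Rightarrow> real" where
  "L2_norm \<psi> = sqrt (LINT z|lborel. (cmod (\<psi> z))\<^sup>2)"

text \<open>\<open>bargmann_kernel k z w\<close> is the kernel written \<open>\<Pi>\<^sub>k(z, w\<^sup>*)\<close>, with \<open>w\<^sup>*\<close> the conjugate of \<open>w\<close>.\<close>

definition bargmann_kernel :: "real \<Rightarrow> complex ^ 'n \<Rightarrow> complex ^ 'n \<Rightarrow> complex" where
  "bargmann_kernel k z w =
     complex_of_real ((k / pi) ^ CARD('n)) *
     exp (complex_of_real k * (\<Sum>j\<in>UNIV. z $ j * cnj (w $ j))
          - complex_of_real (k * (norm z)\<^sup>2 / 2) - complex_of_real (k * (norm w)\<^sup>2 / 2))"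

definition toeplitz_integrand ::
  "real \<Rightarrow> (complex ^ 'n \<Rightarrow> complex) \<Rightarrow> (complex ^ 'n \<Rightarrow> complex) \<Rightarrow>
   complex ^ 'n \<Rightarrow> complex ^ 'n \<Rightarrow> complex" where
  "toeplitz_integrand k a \<psi> z w = bargmann_kernel k z w * \<psi> w * a w"

definition toeplitz ::
  "real \<Rightarrow> (complex ^ 'n) measure \<Rightarrow> (complex ^ 'n \<Rightarrow> complex) \<Rightarrow>
   (complex ^ 'n \<Rightarrow> complex) \<Rightarrow> complex ^ 'n \<Rightarrow> complex" where
  "toeplitz k \<sigma> a \<psi> z = (LINT w|\<sigma>. toeplitz_integrand k a \<psi> z w)"

text \<open>Valued in \<^typ>\<open>ennreal\<close> so that the supremum is \<open>\<infinity>\<close> for an unbounded operator.  Meaningful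
  only if \<open>T\<close> maps \<open>H\<close> into square integrable functions.\<close>

definition op_norm_on ::
  "(complex ^ 'n \<Rightarrow> complex) set \<Rightarrow>
   ((complex ^ 'n \<Rightarrow> complex) \<Rightarrow> (complex ^ 'n \<Rightarrow> complex)) \<Rightarrow> ennreal" where
  "op_norm_on H T = (SUP \<psi>\<in>{\<psi> \<in> H. L2_norm \<psi> \<le> 1}. ennreal (L2_norm (T \<psi>)))"

end

theory Submission
  imports Defs "HOL-Complex_Analysis.Cauchy_Integral_Formula" "HOL-Real_Asymp.Real_Asymp"
begin

text \<open>The size of \<open>T\<close> is governed by one geometric fact.  Let \<open>K\<close> be the compact support of \<open>a\<close>.  In a slice
chart the map is bi-Lipschitz and its Gram density bounded, so \<open>\<sigma> (K \<inter> cball z r) \<le> C * r ^ d\<close>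
for all \<open>z\<close> and \<open>r > 0\<close> (\<open>compact_submanifold_growth\<close>).  As \<open>K\<close> has finite measure, this holds
for large radii as well as for small ones, which is why the final estimate covers all \<open>k > 0\<close>
and not only large \<open>k\<close>.

The kernel has modulus \<open>(k / pi) ^ N * exp (- (k * (dist z w)\<^sup>2 / 2))\<close>, a Gaussian of width
\<open>1 / sqrt k\<close>.  By the growth bound its \<open>\<sigma>\<close>-mass over \<open>K\<close>, without the factor \<open>(k / pi) ^ N\<close>, is
\<open>O(k powr (- d / 2))\<close>; the bound for Lebesgue measure, with \<open>2 * N\<close> for \<open>d\<close>, gives \<open>O(k powr (- N))\<close>
in the other variable (\<open>gaussian_integral_le\<close>).  The Schur test turns these into a bound of
the \<open>L\<^sup>2\<close> norm of \<open>T \<psi>\<close> by the \<open>L\<^sup>2(\<sigma>)\<close> norm of \<open>\<psi>\<close> on \<open>K\<close>.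

It remains to compare that norm with the one of \<open>\<psi>\<close> on \<open>\<complex>\<^sup>N\<close>, and here holomorphy enters.
Twisting an entire function by \<open>exp (- k * herm u w)\<close> recentres the Gaussian weight at \<open>w\<close>, so
the mean value property bounds \<open>(cmod (\<psi> w))\<^sup>2\<close> by a constant times the average of \<open>(cmod \<psi>)\<^sup>2\<close> over
the ball of radius \<open>1 / sqrt k\<close> about \<open>w\<close> (\<open>bargmann_local_bound\<close>).  Integrating over \<open>K\<close> and using the
growth bound once more gives the Carleson embedding \<open>bargmann_carleson\<close>, with constant
\<open>O(k powr (N - d / 2))\<close>.  Collecting the powers of \<open>k\<close> in the square of the norm gives
\<open>2 * N - d / 2 - N + (N - d / 2) = 2 * (N - d / 2)\<close>.

That \<open>T \<psi>\<close> is again of the form (entire) times (Gaussian) is differentiation under the integral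
sign over the bounded set \<open>K\<close> (\<open>entire_exp_integral\<close>).\<close>

section \<open>Rotation invariance and circle means\<close>

text \<open>The image measure \<open>\<nu>\<close> is translation invariant and gives the unit ball its Lebesgue measure.  Two
translation-invariant measures are proportional: integrating the indicator of
\<open>{(x, y). y + x \<in> A \<and> y \<in> B}\<close> for the product of the two measures in both orders gives
\<open>\<nu>(A) * lborel(B) = lborel(A) * \<nu>(B)\<close> for the ball \<open>B\<close>, which is its own mirror image.\<close>

lemma distr_lborel_isometry:
  fixes T :: "'a::euclidean_space \<Rightarrow> 'a"
  assumes T: "linear T" "\<And>x. norm (T x) = norm x"
  shows "distr lborel borel T = lborel"
proof -
  have [measurable]: "T \<in> borel \<rightarrow>\<^sub>M borel"
    using T(1) by (intro borel_measurable_continuous_onI linear_continuous_on)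
      (simp add: linear_conv_bounded_linear)
  have inj: "inj T"
    by (rule linear_injective_0[THEN iffD2, OF T(1)]) (metis T(2) norm_eq_zero)
  then have surj: "surj T"
    using T(1) linear_injective_imp_surjective by blast
  define \<nu> where "\<nu> = distr lborel borel T"
  have sets\<nu>[measurable_cong, simp]: "sets \<nu> = sets borel" by (simp add: \<nu>_def)
  have space\<nu>[simp]: "space \<nu> = UNIV" by (simp add: \<nu>_def)
  have ball: "emeasure \<nu> (cball 0 r) = emeasure lborel (cball 0 r :: 'a set)" for r
    unfolding \<nu>_def by (subst emeasure_distr) (auto simp: vimage_def T(2) cball_def)
  interpret \<nu>: sigma_finite_measure \<nu>
  proof
    show "\<exists>A. countable A \<and> A \<subseteq> sets \<nu> \<and> \<Union> A = space \<nu> \<and> (\<forall>a\<in>A. emeasure \<nu> a \<noteq> \<infinity>)"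
      by (rule exI[of _ "range (\<lambda>n::nat. cball 0 (real n))"])
        (use emeasure_lborel_cball_finite[of "0::'a"] in \<open>auto simp: ball real_arch_simple less_top\<close>)
  qed
  interpret P: pair_sigma_finite lborel \<nu> ..
  have inv\<nu>: "distr \<nu> borel ((+) c) = \<nu>" for c
  proof -
    obtain b where c: "c = T b" using surj by auto
    have "distr \<nu> borel ((+) c) = distr lborel borel ((+) c \<circ> T)"
      unfolding \<nu>_def by (subst distr_distr) auto
    also have "(+) c \<circ> T = T \<circ> (+) b"
      by (auto simp: c linear_add[OF T(1)])
    also have "distr lborel borel (T \<circ> (+) b) = distr (distr lborel borel ((+) b)) borel T"
      by (subst distr_distr) auto
    also have "\<dots> = \<nu>" by (simp add: lborel_distr_plus \<nu>_def)
    finally show ?thesis .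
  qed
  have shift: "emeasure \<nu> ((+) c -` A) = emeasure \<nu> A" if "A \<in> sets borel" for A c
    using that by (subst (2) inv\<nu>[symmetric, of c]) (simp add: emeasure_distr)
  have "emeasure \<nu> A = emeasure lborel A" if A[measurable]: "A \<in> sets borel" for A :: "'a set"
  proof -
    let ?B = "cball 0 1 :: 'a set"
    have [measurable]: "?B \<in> sets borel" by simp
    have "emeasure \<nu> A * emeasure lborel ?B
        = (\<integral>\<^sup>+y. emeasure \<nu> A * indicator ?B y \<partial>lborel)"
      by (simp add: nn_integral_cmult_indicator)
    also have "\<dots> = (\<integral>\<^sup>+y. (\<integral>\<^sup>+x. indicator A (y + x) * indicator ?B y \<partial>\<nu>) \<partial>lborel)"
    proof (rule nn_integral_cong)
      fix y :: 'a
      have "(\<integral>\<^sup>+x. indicator A (y + x) * indicator ?B y \<partial>\<nu>)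
          = (\<integral>\<^sup>+x. indicator A (y + x) \<partial>\<nu>) * indicator ?B y"
        by (rule nn_integral_multc) simp
      also have "(\<integral>\<^sup>+x. indicator A (y + x) \<partial>\<nu>) = (\<integral>\<^sup>+x. indicator ((+) y -` A) x \<partial>\<nu>)"
        by (simp add: indicator_def)
      also have "\<dots> = emeasure \<nu> ((+) y -` A)"
        by (rule nn_integral_indicator) (use measurable_sets_borel[of "(+) y" borel A] in simp)
      also have "\<dots> = emeasure \<nu> A" by (rule shift) simp
      finally show "emeasure \<nu> A * indicator ?B y
          = (\<integral>\<^sup>+x. indicator A (y + x) * indicator ?B y \<partial>\<nu>)" by simp
    qed
    also have "\<dots> = (\<integral>\<^sup>+x. (\<integral>\<^sup>+y. indicator A (y + x) * indicator ?B y \<partial>lborel) \<partial>\<nu>)"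
      by (rule P.Fubini'[symmetric]) measurable
    \<comment> \<open>Substitute \<open>y - x\<close> for \<open>y\<close>, using the translation invariance of Lebesgue measure.\<close>
    also have "\<dots> = (\<integral>\<^sup>+x. (\<integral>\<^sup>+y. indicator A y * indicator ?B (y - x) \<partial>lborel) \<partial>\<nu>)"
    proof (rule nn_integral_cong)
      fix x :: 'a
      show "(\<integral>\<^sup>+y. indicator A (y + x) * indicator ?B y \<partial>lborel)
          = (\<integral>\<^sup>+y. indicator A y * indicator ?B (y - x) \<partial>lborel)"
        by (subst (2) lborel_distr_plus[symmetric, of x], subst nn_integral_distr)
          (simp_all add: add.commute)
    qed
    also have "\<dots> = (\<integral>\<^sup>+y. (\<integral>\<^sup>+x. indicator A y * indicator ?B (y - x) \<partial>\<nu>) \<partial>lborel)"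
      by (rule P.Fubini') measurable
    also have "\<dots> = (\<integral>\<^sup>+y. emeasure lborel ?B * indicator A y \<partial>lborel)"
    proof (rule nn_integral_cong)
      fix y :: 'a
      have "(\<integral>\<^sup>+x. indicator A y * indicator ?B (y - x) \<partial>\<nu>)
          = indicator A y * (\<integral>\<^sup>+x. indicator ?B (y - x) \<partial>\<nu>)"
        by (rule nn_integral_cmult) simp
      also have "(\<integral>\<^sup>+x. indicator ?B (y - x) \<partial>\<nu>) = (\<integral>\<^sup>+x. indicator ((+) (-y) -` ?B) x \<partial>\<nu>)"
        by (intro nn_integral_cong) (auto simp: indicator_def norm_minus_commute)
      also have "\<dots> = emeasure \<nu> ((+) (-y) -` ?B)"
        by (rule nn_integral_indicator) (use measurable_sets_borel[of "(+) (-y)" borel ?B] in simp)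
      also have "\<dots> = emeasure lborel ?B" by (simp add: shift ball)
      finally show "(\<integral>\<^sup>+x. indicator A y * indicator ?B (y - x) \<partial>\<nu>)
          = emeasure lborel ?B * indicator A y" by (simp add: mult.commute)
    qed
    also have "\<dots> = emeasure lborel A * emeasure lborel ?B"
      by (subst nn_integral_cmult_indicator) (simp_all add: mult.commute)
    finally have eq: "emeasure lborel ?B * emeasure \<nu> A = emeasure lborel ?B * emeasure lborel A"
      by (simp add: mult.commute)
    have "emeasure lborel ?B \<noteq> 0"
      using emeasure_cball[of 1 "0::'a"] less_imp_neq[OF unit_ball_vol_pos[of "real DIM('a)"]] by simp
    moreover have "emeasure lborel ?B \<noteq> \<infinity>"
      using emeasure_lborel_cball_finite[of "0::'a" 1] by simp
    ultimately show ?thesis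
      using eq by (auto simp: ennreal_mult_cancel_left)
  qed
  then show ?thesis
    unfolding \<nu>_def by (intro measure_eqI) simp_all
qed

text \<open>Cauchy's formula for the value at the centre of the unit circle.\<close>

lemma cmod_le_circle_mean:
  assumes "h holomorphic_on UNIV"
  shows "ennreal (cmod (h 0))
    \<le> (\<integral>\<^sup>+t. ennreal (cmod (h (exp (2 * of_real pi * \<i> * of_real t)))) * indicator {0..1} t \<partial>lborel)"
proof -
  let ?e = "\<lambda>t::real. exp (2 * of_real pi * \<i> * of_real t)"
  have "((\<lambda>u. h u / (u - 0)) has_contour_integral (2 * of_real pi * \<i> * h 0)) (circlepath 0 1)"
    by (rule Cauchy_integral_circlepath_simple) (use assms holomorphic_on_subset in auto)
  then have "((\<lambda>x. h (?e x) * (2 * of_real pi * \<i>)) has_integral (2 * of_real pi * \<i> * h 0)) {0..1}"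
    unfolding has_contour_integral_def
  proof (rule has_integral_eq[rotated])
    fix x :: real assume x: "x \<in> {0..1}"
    have "vector_derivative (circlepath 0 1) (at x within {0..1}) = 2 * of_real pi * \<i> * ?e x"
      using vector_derivative_circlepath01[of x 0 1] x by simp
    then show "h (circlepath 0 1 x) / (circlepath 0 1 x - 0)
        * vector_derivative (circlepath 0 1) (at x within {0..1})
      = h (?e x) * (2 * of_real pi * \<i>)"
      by (simp add: circlepath)
  qed
  then have "((\<lambda>x. h (?e x) * (2 * of_real pi * \<i>) * (1 / (2 * of_real pi * \<i>)))
      has_integral (2 * of_real pi * \<i> * h 0 * (1 / (2 * of_real pi * \<i>)))) {0..1}"
    by (rule has_integral_mult_left)
  then have I: "((\<lambda>x. h (?e x)) has_integral h 0) {0..1}"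
    by (simp add: field_simps)
  have ch: "continuous_on UNIV h"
    using assms holomorphic_on_imp_continuous_on by blast
  have "continuous_on UNIV (\<lambda>x. h (?e x))"
    by (intro continuous_on_compose2[OF ch] continuous_intros) auto
  then have S: "set_integrable lborel {0..1} (\<lambda>x. h (?e x))"
    by (intro borel_integrable_atLeastAtMost') (rule continuous_on_subset, auto)
  have "h 0 = (LINT t:{0..1}|lborel. h (?e t))"
    using set_borel_integral_eq_integral(2)[OF S] I by (simp add: integral_unique)
  also have "ennreal (cmod \<dots>) \<le> (\<integral>\<^sup>+t. ennreal (cmod (indicator {0..1} t *\<^sub>R h (?e t))) \<partial>lborel)"
    unfolding set_lebesgue_integral_def
    by (rule integral_norm_bound_ennreal) (use S in \<open>simp add: set_integrable_def\<close>)
  also have "\<dots> = (\<integral>\<^sup>+t. ennreal (cmod (h (?e t))) * indicator {0..1} t \<partial>lborel)"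
    by (intro nn_integral_cong) (auto simp: indicator_def)
  finally show ?thesis .
qed



section \<open>Entire functions and Bargmann space\<close>

definition herm :: "complex ^ 'n \<Rightarrow> complex ^ 'n \<Rightarrow> complex" where
  "herm z w = (\<Sum>j\<in>UNIV. z $ j * cnj (w $ j))"

lemma herm_add_left: "herm (x + y) w = herm x w + herm y w"
  by (simp add: herm_def distrib_right sum.distrib)

lemma herm_smult_left: "herm (c *s x) w = c * herm x w"
  by (simp add: herm_def sum_distrib_left mult_ac)

lemma Re_herm: "Re (herm z w) = z \<bullet> w"
  by (simp add: herm_def inner_vec_def inner_complex_def)

lemma norm_herm_le: "cmod (herm z w) \<le> norm z * norm w"
proof -
  have "cmod (herm z w) \<le> (\<Sum>j\<in>UNIV. \<bar>cmod (z $ j)\<bar> * \<bar>cmod (w $ j)\<bar>)"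
    unfolding herm_def by (rule order_trans[OF norm_sum]) (simp add: norm_mult)
  also have "\<dots> \<le> norm z * norm w"
    unfolding norm_vec_def by (rule L2_set_mult_ineq)
  finally show ?thesis .
qed

lemma continuous_on_herm [continuous_intros]:
  "continuous_on S f \<Longrightarrow> continuous_on S g \<Longrightarrow> continuous_on S (\<lambda>x. herm (f x) (g x))"
  unfolding herm_def by (intro continuous_intros)

lemma norm_vector_smult: "norm (c *s (u :: complex ^ 'n)) = cmod c * norm u"
  by (simp add: norm_vec_def norm_mult L2_set_right_distrib)

lemma continuous_on_vector_smult [continuous_intros]:
  fixes g :: "'a::topological_space \<Rightarrow> complex ^ 'n"
  shows "continuous_on S f \<Longrightarrow> continuous_on S g \<Longrightarrow> continuous_on S (\<lambda>x. f x *s g x)"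
  unfolding vector_scalar_mult_def by (intro continuous_intros)

lemma linear_vector_smult: "linear (\<lambda>u :: complex ^ 'n. c *s u)"
  by (rule linearI) (simp_all add: vec_eq_iff algebra_simps)

lemma norm_bargmann_kernel:
  fixes z w :: "complex ^ 'n"
  assumes "k \<ge> 0"
  shows "cmod (bargmann_kernel k z w) = (k / pi) ^ CARD('n) * exp (- (k * (dist z w)\<^sup>2 / 2))"
proof -
  have "(dist z w)\<^sup>2 = (norm z)\<^sup>2 + (norm w)\<^sup>2 - 2 * (z \<bullet> w)"
    by (simp add: dist_norm power2_norm_eq_inner inner_diff inner_commute)
  then have "k * (z \<bullet> w) - k * (norm z)\<^sup>2 / 2 - k * (norm w)\<^sup>2 / 2 = - (k * (dist z w)\<^sup>2 / 2)"
    by (simp only:) (simp add: field_simps)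
  then show ?thesis
    using assms unfolding bargmann_kernel_def herm_def[symmetric]
    by (simp add: norm_mult norm_divide norm_power Re_herm)
qed

lemma entire_continuous_on: "entire f \<Longrightarrow> continuous_on S f"
  unfolding entire_def
  by (meson continuous_at_imp_continuous_on has_derivative_continuous)

lemma entire_along_line:
  assumes "entire f"
  shows "(\<lambda>c. f (w + c *s u)) holomorphic_on S"
proof -
  have "\<exists>D. ((\<lambda>c. f (w + c *s u)) has_field_derivative D) (at x)" for x
  proof -
    obtain D where D: "(f has_derivative D) (at (w + x *s u))"
      and lin: "\<And>c v. D (c *s v) = c * D v"
      using assms unfolding entire_def by meson
    have bl: "bounded_linear (\<lambda>c::complex. c *s u)"
      by (subst linear_conv_bounded_linear[symmetric], rule linearI)
        (simp_all add: vec_eq_iff algebra_simps)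
    have "((\<lambda>c. w + c *s u) has_derivative (\<lambda>c. c *s u)) (at x)"
      using bounded_linear_imp_has_derivative[OF bl, of "at x"]
      by (auto intro!: derivative_eq_intros)
    from has_derivative_compose[OF this D]
    have "((\<lambda>c. f (w + c *s u)) has_derivative (\<lambda>c. D u * c)) (at x)"
      by (simp add: lin mult.commute)
    then show ?thesis
      by (auto simp: has_field_derivative_def)
  qed
  then show ?thesis
    by (auto simp: holomorphic_on_def field_differentiable_def) (meson has_field_derivative_at_within)
qed

lemma bargmann_space_continuous:
  assumes "\<psi> \<in> bargmann_space k"
  shows "continuous_on S \<psi>"
proof -
  obtain f where "entire f" "\<psi> = (\<lambda>z. f z * exp (complex_of_real (- k * (norm z)\<^sup>2 / 2)))"
    using assms unfolding bargmann_space_def by auto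
  then show ?thesis
    using entire_continuous_on[of f S] by (auto intro!: continuous_intros)
qed

text \<open>The mean value inequality is applied along the complex line through \<open>w\<close> in direction \<open>u\<close>, to
\<open>c \<mapsto> (f (w + c *s u))\<^sup>2 * exp (- 2 * k * c * herm u w)\<close>.  The exponential factor cancels the cross term
of \<open>(norm (w + c *s u))\<^sup>2\<close>, so that on the unit circle the modulus is that of \<open>\<psi>\<^sup>2\<close> up to a factor
that does not depend on \<open>c\<close>.\<close>

lemma bargmann_circle_mean:
  fixes w u :: "complex ^ 'n"
  assumes "\<psi> \<in> bargmann_space k"
  shows "ennreal ((cmod (\<psi> w))\<^sup>2) \<le> ennreal (exp (k * (norm u)\<^sup>2)) *
    (\<integral>\<^sup>+t. ennreal ((cmod (\<psi> (w + exp (2 * of_real pi * \<i> * of_real t) *s u)))\<^sup>2)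
       * indicator {0..1} t \<partial>lborel)"
proof -
  let ?e = "\<lambda>t::real. exp (2 * of_real pi * \<i> * of_real t)"
  obtain f where f: "entire f" and \<psi>: "\<psi> = (\<lambda>z. f z * exp (complex_of_real (- k * (norm z)\<^sup>2 / 2)))"
    using assms unfolding bargmann_space_def by auto
  have [measurable]: "\<psi> \<in> borel \<rightarrow>\<^sub>M borel"
    using bargmann_space_continuous[OF assms] by (rule borel_measurable_continuous_onI)
  have [measurable]: "(\<lambda>t::real. ?e t *s u) \<in> borel \<rightarrow>\<^sub>M borel"
    by (intro borel_measurable_continuous_onI continuous_intros)
  have sq: "(cmod (\<psi> z))\<^sup>2 = (cmod (f z))\<^sup>2 * exp (- k * (norm z)\<^sup>2)" for z
    by (simp add: \<psi> norm_mult power_mult_distrib flip: exp_double)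
  define h where "h c = (f (w + c *s u))\<^sup>2 * exp (- 2 * of_real k * c * herm u w)" for c
  have "h holomorphic_on UNIV"
    unfolding h_def by (intro holomorphic_intros entire_along_line f)
  note mean = cmod_le_circle_mean[OF this]
  have h0: "cmod (h 0) = (cmod (\<psi> w))\<^sup>2 * exp (k * (norm w)\<^sup>2)"
    by (simp add: h_def sq norm_power mult.assoc flip: exp_add)
  have collect_exp: "exp (k * W) * (exp (k * U) * exp (- k * n)) = exp (- 2 * k * R)"
    if "n = W + U + 2 * R" for W U n R :: real
    by (simp add: that algebra_simps flip: exp_add)
  have h1: "cmod (h (?e t))
    = exp (k * (norm w)\<^sup>2) * (exp (k * (norm u)\<^sup>2) * (cmod (\<psi> (w + ?e t *s u)))\<^sup>2)" for t
  proof -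
    have "(norm (w + ?e t *s u))\<^sup>2 = (norm w)\<^sup>2 + (norm u)\<^sup>2 + 2 * Re (?e t * herm u w)"
    proof -
      have "(norm (w + ?e t *s u))\<^sup>2 = (norm w)\<^sup>2 + (norm (?e t *s u))\<^sup>2 + 2 * ((?e t *s u) \<bullet> w)"
        by (simp only: power2_norm_eq_inner inner_add inner_commute)
      then show ?thesis
        by (simp add: norm_vector_smult norm_exp_eq_Re Re_herm[symmetric] herm_smult_left)
    qed
    then have "exp (k * (norm w)\<^sup>2) * (exp (k * (norm u)\<^sup>2) * exp (- k * (norm (w + ?e t *s u))\<^sup>2))
        = exp (- 2 * k * Re (?e t * herm u w))"
      by (rule collect_exp)
    moreover have "cmod (exp (- 2 * of_real k * ?e t * herm u w)) = exp (- 2 * k * Re (?e t * herm u w))"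
      by (simp add: norm_exp_eq_Re algebra_simps)
    ultimately have E: "cmod (exp (- 2 * of_real k * ?e t * herm u w))
      = exp (k * (norm w)\<^sup>2) * (exp (k * (norm u)\<^sup>2) * exp (- k * (norm (w + ?e t *s u))\<^sup>2))"
      by (simp only:)
    show ?thesis
      unfolding h_def norm_mult[of "(f _)\<^sup>2"] E sq norm_power by (simp only: mult_ac)
  qed
  have "ennreal (exp (k * (norm w)\<^sup>2)) * ennreal ((cmod (\<psi> w))\<^sup>2)
     = ennreal (cmod (h 0))" by (simp add: h0 mult.commute flip: ennreal_mult)
  also have "\<dots> \<le> (\<integral>\<^sup>+t. ennreal (exp (k * (norm w)\<^sup>2)) * (ennreal (exp (k * (norm u)\<^sup>2)) *
       (ennreal ((cmod (\<psi> (w + ?e t *s u)))\<^sup>2) * indicator {0..1} t)) \<partial>lborel)"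
    by (rule order_trans[OF mean]) (simp only: h1, simp add: ennreal_mult mult.assoc)
  also have "\<dots> = ennreal (exp (k * (norm w)\<^sup>2)) * (\<integral>\<^sup>+t. (ennreal (exp (k * (norm u)\<^sup>2)) *
       (ennreal ((cmod (\<psi> (w + ?e t *s u)))\<^sup>2) * indicator {0..1} t)) \<partial>lborel)"
    by (rule nn_integral_cmult) measurable
  also have "(\<integral>\<^sup>+t. (ennreal (exp (k * (norm u)\<^sup>2)) *
       (ennreal ((cmod (\<psi> (w + ?e t *s u)))\<^sup>2) * indicator {0..1} t)) \<partial>lborel)
     = ennreal (exp (k * (norm u)\<^sup>2)) * (\<integral>\<^sup>+t. 
       (ennreal ((cmod (\<psi> (w + ?e t *s u)))\<^sup>2) * indicator {0..1} t) \<partial>lborel)"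
    by (rule nn_integral_cmult) measurable
  finally show ?thesis
    by (subst (asm) ennreal_mult_le_mult_iff) simp_all
qed

text \<open>Integrate the circle mean over directions \<open>u\<close> in a ball.  Rotating \<open>u\<close> by a phase preserves the
ball and Lebesgue measure, so after exchanging the integrals the integral over the circle drops out.\<close>

lemma bargmann_local_bound:
  fixes w :: "complex ^ 'n"
  assumes \<psi>: "\<psi> \<in> bargmann_space k" and k: "k \<ge> 0"
  shows "ennreal ((cmod (\<psi> w))\<^sup>2) * emeasure lborel (cball 0 r :: (complex ^ 'n) set)
    \<le> ennreal (exp (k * r\<^sup>2)) *
       (\<integral>\<^sup>+z. ennreal ((cmod (\<psi> z))\<^sup>2) * indicator (cball w r) z \<partial>lborel)"
proof -
  let ?e = "\<lambda>t::real. exp (2 * of_real pi * \<i> * of_real t) :: complex"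
  let ?B = "cball 0 r :: (complex ^ 'n) set"
  have [measurable]: "?B \<in> sets borel" by simp
  define P where "P z = ennreal ((cmod (\<psi> z))\<^sup>2)" for z
  have "\<psi> \<in> borel \<rightarrow>\<^sub>M borel"
    using bargmann_space_continuous[OF \<psi>] by (rule borel_measurable_continuous_onI)
  then have P[measurable]: "P \<in> borel \<rightarrow>\<^sub>M borel" unfolding P_def by measurable
  have [measurable]: "(\<lambda>(t, u :: complex ^ 'n). ?e t *s u) \<in> borel \<Otimes>\<^sub>M borel \<rightarrow>\<^sub>M borel"
    unfolding borel_prod by (intro borel_measurable_continuous_onI)
      (simp add: case_prod_beta, intro continuous_intros)
  have ne: "cmod (?e t) = 1" for t by (simp add: norm_exp_eq_Re)
  have "P w * emeasure lborel ?B = (\<integral>\<^sup>+u. P w * indicator ?B u \<partial>lborel)"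
    by (simp add: nn_integral_cmult_indicator)
  also have "\<dots> \<le> (\<integral>\<^sup>+u. ennreal (exp (k * r\<^sup>2)) *
     (\<integral>\<^sup>+t. P (w + ?e t *s u) * indicator {0..1} t * indicator ?B (?e t *s u) \<partial>lborel) \<partial>lborel)"
  proof (rule nn_integral_mono)
    fix u :: "complex ^ 'n"
    show "P w * indicator ?B u \<le> ennreal (exp (k * r\<^sup>2)) *
     (\<integral>\<^sup>+t. P (w + ?e t *s u) * indicator {0..1} t * indicator ?B (?e t *s u) \<partial>lborel)"
    proof (cases "u \<in> ?B")
      case True
      then have "indicator ?B (?e t *s u) = (1::ennreal)" for t
        by (simp add: norm_vector_smult ne)
      moreover have "k * (norm u)\<^sup>2 \<le> k * r\<^sup>2"
        using True k by (intro mult_left_mono power_mono) auto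
      ultimately show ?thesis
        using True unfolding P_def
        by (simp, intro order_trans[OF bargmann_circle_mean[OF \<psi>, of w u]] mult_right_mono ennreal_leI)
          (simp_all add: exp_le_cancel_iff)
    qed simp
  qed
  also have "\<dots> = ennreal (exp (k * r\<^sup>2)) * (\<integral>\<^sup>+u.
     (\<integral>\<^sup>+t. P (w + ?e t *s u) * indicator {0..1} t * indicator ?B (?e t *s u) \<partial>lborel) \<partial>lborel)"
    by (rule nn_integral_cmult) measurable
  also have "(\<integral>\<^sup>+u. (\<integral>\<^sup>+t. P (w + ?e t *s u) * indicator {0..1} t * indicator ?B (?e t *s u) \<partial>lborel) \<partial>lborel)
    = (\<integral>\<^sup>+t. (\<integral>\<^sup>+u. P (w + ?e t *s u) * indicator {0..1} t * indicator ?B (?e t *s u) \<partial>lborel) \<partial>lborel)"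
    by (rule pair_sigma_finite.Fubini') (unfold_locales, measurable)
  also have "\<dots> = (\<integral>\<^sup>+t. (\<integral>\<^sup>+u. P (w + u) * indicator ?B u \<partial>lborel) * indicator {0..1} (t::real) \<partial>lborel)"
  proof (rule nn_integral_cong)
    fix t :: real
    have "(\<integral>\<^sup>+u. P (w + ?e t *s u) * indicator ?B (?e t *s u) \<partial>lborel)
      = (\<integral>\<^sup>+u. P (w + u) * indicator ?B u \<partial>distr lborel borel (\<lambda>u :: complex ^ 'n. ?e t *s u))"
      by (subst nn_integral_distr) simp_all
    also have "distr lborel borel (\<lambda>u :: complex ^ 'n. ?e t *s u) = lborel"
      by (rule distr_lborel_isometry) (simp_all add: linear_vector_smult norm_vector_smult ne)
    finally show "(\<integral>\<^sup>+u. P (w + ?e t *s u) * indicator {0..1} t * indicator ?B (?e t *s u) \<partial>lborel)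
      = (\<integral>\<^sup>+u. P (w + u) * indicator ?B u \<partial>lborel) * indicator {0..1} t"
      by (auto simp: indicator_def[of "{0..1::real}"])
  qed
  also have "\<dots> = (\<integral>\<^sup>+u. P (w + u) * indicator ?B u \<partial>lborel)"
    by (simp add: nn_integral_cmult_indicator)
  also have "\<dots> = (\<integral>\<^sup>+z. P z * indicator (cball w r) z \<partial>lborel)"
    by (subst (2) lborel_distr_plus[symmetric, of w], subst nn_integral_distr)
      (simp_all add: indicator_def dist_norm)
  finally show ?thesis by (simp add: P_def)
qed



section \<open>Gaussian integrals against measures of polynomial growth\<close>

text \<open>The \<open>j\<close>-th term bounds the integral of \<open>exp (- (dist z w)\<^sup>2 / 2)\<close> over the shell between the radii
\<open>j\<close> and \<open>j + 1\<close>, when a ball of radius \<open>j + 1\<close> has measure at most \<open>(j + 1) ^ d\<close>.\<close>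

definition shell_sum :: "nat \<Rightarrow> real" where
  "shell_sum d = (\<Sum>j. exp (- ((real j)\<^sup>2 / 2)) * (real j + 1) ^ d)"

lemma summable_shells: "summable (\<lambda>j. exp (- ((real j)\<^sup>2 / 2)) * (real j + 1) ^ d)"
proof (rule summable_comparison_test_bigo)
  show "summable (\<lambda>j. norm (1 / real j ^ 2))"
    using inverse_power_summable[of 2, where 'a = real] by (simp add: field_simps)
  show "(\<lambda>j. exp (- ((real j)\<^sup>2 / 2)) * (real j + 1) ^ d) \<in> O(\<lambda>j. 1 / real j ^ 2)"
    by real_asymp
qed

lemma shell_sum_nonneg: "shell_sum d \<ge> 0"
  unfolding shell_sum_def by (intro suminf_nonneg summable_shells) simp

lemma inverse_sqrt_power: "k > 0 \<Longrightarrow> (1 / sqrt k) ^ d = k powr (- (real d / 2))"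
  by (simp add: powr_half_sqrt[symmetric] powr_minus powr_realpow[symmetric] powr_powr
      power_divide power_one_over field_simps)

text \<open>Decompose the space into shells of width \<open>1 / sqrt k\<close> about \<open>z\<close> and bound each shell by the ball that
contains it.\<close>

lemma gaussian_integral_le:
  fixes \<mu> :: "'a::euclidean_space measure"
  assumes [measurable_cong]: "sets \<mu> = sets borel" and C: "C \<ge> 0" and k: "k > 0"
    and growth: "\<And>r. r > 0 \<Longrightarrow> emeasure \<mu> (cball z r) \<le> ennreal (C * r ^ d)"
  shows "(\<integral>\<^sup>+w. ennreal (exp (- (k * (dist z w)\<^sup>2 / 2))) \<partial>\<mu>)
    \<le> ennreal (C * shell_sum d * k powr (- (real d / 2)))"
proof -
  define r where "r = 1 / sqrt k"
  have r: "r > 0" "k = 1 / r\<^sup>2" using k by (simp_all add: r_def power_divide)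
  let ?c = "\<lambda>j::nat. exp (- ((real j)\<^sup>2 / 2))"
  let ?B = "\<lambda>j::nat. cball z ((real j + 1) * r)"
  have [measurable]: "?B j \<in> sets borel" for j by simp
  have "(\<integral>\<^sup>+w. ennreal (exp (- (k * (dist z w)\<^sup>2 / 2))) \<partial>\<mu>)
      \<le> (\<integral>\<^sup>+w. (\<Sum>j. ennreal (?c j) * indicator (?B j) w) \<partial>\<mu>)"
  proof (rule nn_integral_mono)
    fix w
    \<comment> \<open>The term of the shell that contains \<open>w\<close> already dominates.\<close>
    define j where "j = nat \<lfloor>dist z w / r\<rfloor>"
    have "0 \<le> dist z w / r" using r by simp
    then have j: "real j \<le> dist z w / r" "dist z w / r < real j + 1"
      unfolding j_def by linarith+
    have "(real j)\<^sup>2 \<le> (dist z w / r)\<^sup>2" using j by (intro power_mono) auto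
    then have "ennreal (exp (- (k * (dist z w)\<^sup>2 / 2))) \<le> ennreal (?c j)"
      by (intro ennreal_leI) (simp add: r(2) power_divide)
    also have "\<dots> = (\<Sum>i\<in>{j}. ennreal (?c i) * indicator (?B i) w)"
      using j r by (simp add: pos_divide_less_eq less_imp_le)
    also have "\<dots> \<le> (\<Sum>j. ennreal (?c j) * indicator (?B j) w)"
      by (rule sum_le_suminf) auto
    finally show "ennreal (exp (- (k * (dist z w)\<^sup>2 / 2)))
      \<le> (\<Sum>j. ennreal (?c j) * indicator (?B j) w)" .
  qed
  also have "\<dots> = (\<Sum>j. \<integral>\<^sup>+w. ennreal (?c j) * indicator (?B j) w \<partial>\<mu>)"
    by (rule nn_integral_suminf) measurable
  also have "\<dots> = (\<Sum>j. ennreal (?c j) * emeasure \<mu> (?B j))"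
    using assms(1) by (simp add: nn_integral_cmult_indicator)
  also have "\<dots> \<le> (\<Sum>j. ennreal ((C * r ^ d) * (?c j * (real j + 1) ^ d)))"
  proof (intro suminf_le summableI)
    fix j
    have "ennreal (?c j) * emeasure \<mu> (?B j) \<le> ennreal (?c j) * ennreal (C * ((real j + 1) * r) ^ d)"
      using r by (intro mult_left_mono growth) auto
    also have "\<dots> = ennreal ((C * r ^ d) * (?c j * (real j + 1) ^ d))"
      using C r by (simp add: ennreal_mult[symmetric] power_mult_distrib mult_ac)
    finally show "ennreal (?c j) * emeasure \<mu> (?B j) \<le> ennreal ((C * r ^ d) * (?c j * (real j + 1) ^ d))" .
  qed
  also have "\<dots> = ennreal (\<Sum>j. (C * r ^ d) * (?c j * (real j + 1) ^ d))"
    using C r by (intro suminf_ennreal2 summable_mult summable_shells) simp_all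
  also have "(\<Sum>j. (C * r ^ d) * (?c j * (real j + 1) ^ d)) = C * r ^ d * shell_sum d"
    unfolding shell_sum_def by (rule suminf_mult[OF summable_shells])
  also have "r ^ d = k powr (- (real d / 2))"
    unfolding r_def by (rule inverse_sqrt_power[OF k])
  finally show ?thesis by (simp add: mult_ac)
qed

lemma ennreal_mult_collect3:
  "a \<ge> 0 \<Longrightarrow> b \<ge> 0 \<Longrightarrow> c \<ge> 0 \<Longrightarrow>
    ennreal a * (ennreal b * (ennreal c * x)) = ennreal (a * b * c) * x"
  by (simp add: ennreal_mult mult.assoc)

text \<open>The positive kernel is written as a square \<open>(e x y)\<^sup>2\<close>, so that no square roots appear when
the Cauchy--Schwarz inequality splits it as \<open>e * (e * g)\<close>.\<close>

lemma schur_test: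
  fixes e :: "'a \<Rightarrow> 'b \<Rightarrow> ennreal"
  assumes "sigma_finite_measure M" "sigma_finite_measure N"
    and e[measurable]: "(\<lambda>(x, y). e x y) \<in> borel_measurable (M \<Otimes>\<^sub>M N)"
    and g[measurable]: "g \<in> borel_measurable N"
    and row: "\<And>x. x \<in> space M \<Longrightarrow> (\<integral>\<^sup>+y. (e x y)\<^sup>2 \<partial>N) \<le> S"
    and col: "\<And>y. y \<in> space N \<Longrightarrow> (\<integral>\<^sup>+x. (e x y)\<^sup>2 \<partial>M) \<le> G"
  shows "(\<integral>\<^sup>+x. (\<integral>\<^sup>+y. (e x y)\<^sup>2 * g y \<partial>N)\<^sup>2 \<partial>M) \<le> S * (G * (\<integral>\<^sup>+y. (g y)\<^sup>2 \<partial>N))"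
proof -
  interpret N: sigma_finite_measure N by fact
  interpret P: pair_sigma_finite N M
    using assms(1,2) by (simp add: pair_sigma_finite_def)
  have "(\<integral>\<^sup>+x. (\<integral>\<^sup>+y. (e x y)\<^sup>2 * g y \<partial>N)\<^sup>2 \<partial>M) \<le> (\<integral>\<^sup>+x. S * (\<integral>\<^sup>+y. (e x y * g y)\<^sup>2 \<partial>N) \<partial>M)"
  proof (rule nn_integral_mono)
    fix x assume x[measurable]: "x \<in> space M"
    have "(\<integral>\<^sup>+y. (e x y)\<^sup>2 * g y \<partial>N) = (\<integral>\<^sup>+y. e x y * (e x y * g y) \<partial>N)"
      by (simp add: power2_eq_square mult.assoc)
    also have "\<dots>\<^sup>2 \<le> (\<integral>\<^sup>+y. (e x y)\<^sup>2 \<partial>N) * (\<integral>\<^sup>+y. (e x y * g y)\<^sup>2 \<partial>N)"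
      by (rule Cauchy_Schwarz_nn_integral) measurable
    also have "\<dots> \<le> S * (\<integral>\<^sup>+y. (e x y * g y)\<^sup>2 \<partial>N)"
      by (intro mult_right_mono row x) simp
    finally show "(\<integral>\<^sup>+y. (e x y)\<^sup>2 * g y \<partial>N)\<^sup>2 \<le> S * (\<integral>\<^sup>+y. (e x y * g y)\<^sup>2 \<partial>N)" .
  qed
  also have "\<dots> = S * (\<integral>\<^sup>+x. (\<integral>\<^sup>+y. (e x y * g y)\<^sup>2 \<partial>N) \<partial>M)"
    by (rule nn_integral_cmult) measurable
  also have "(\<integral>\<^sup>+x. (\<integral>\<^sup>+y. (e x y * g y)\<^sup>2 \<partial>N) \<partial>M) = (\<integral>\<^sup>+y. (\<integral>\<^sup>+x. (e x y * g y)\<^sup>2 \<partial>M) \<partial>N)"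
    by (rule P.Fubini') measurable
  also have "\<dots> = (\<integral>\<^sup>+y. (\<integral>\<^sup>+x. (e x y)\<^sup>2 \<partial>M) * (g y)\<^sup>2 \<partial>N)"
    by (intro nn_integral_cong, simp add: power_mult_distrib, intro nn_integral_multc) measurable
  also have "\<dots> \<le> (\<integral>\<^sup>+y. G * (g y)\<^sup>2 \<partial>N)"
    by (intro nn_integral_mono mult_right_mono col) simp_all
  also have "\<dots> = G * (\<integral>\<^sup>+y. (g y)\<^sup>2 \<partial>N)"
    by (rule nn_integral_cmult) measurable
  finally show ?thesis by (simp add: mult_left_mono)
qed

section \<open>The Carleson embedding and Gaussian smoothing\<close>

text \<open>Integrate the local bound at radius \<open>r = 1 / sqrt k\<close> against \<open>\<mu>\<close> and exchange the integrals: each point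
\<open>z\<close> is then weighted by \<open>\<mu> (cball z r)\<close>, which is at most \<open>C * r ^ d\<close>, while the volume of the
ball contributes \<open>r ^ (2 * N)\<close> in the denominator.\<close>

lemma bargmann_carleson:
  fixes \<mu> :: "(complex ^ 'n) measure"
  assumes "sigma_finite_measure \<mu>" and sets\<mu>[measurable_cong]: "sets \<mu> = sets borel"
    and C: "C \<ge> 0" and k: "k > 0"
    and growth: "\<And>z r. r > 0 \<Longrightarrow> emeasure \<mu> (cball z r) \<le> ennreal (C * r ^ d)"
    and \<psi>: "\<psi> \<in> bargmann_space k"
  shows "(\<integral>\<^sup>+w. ennreal ((cmod (\<psi> w))\<^sup>2) \<partial>\<mu>)
    \<le> ennreal (exp 1 / unit_ball_vol (real (2 * CARD('n))) * C * k powr (real CARD('n) - real d / 2))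
       * (\<integral>\<^sup>+z. ennreal ((cmod (\<psi> z))\<^sup>2) \<partial>lborel)"
proof -
  interpret P: pair_sigma_finite \<mu> lborel
    using assms(1) by (simp add: pair_sigma_finite_def sigma_finite_lborel)
  have \<psi>m: "\<psi> \<in> borel \<rightarrow>\<^sub>M borel"
    using bargmann_space_continuous[OF \<psi>] by (rule borel_measurable_continuous_onI)
  define P where "P z = ennreal ((cmod (\<psi> z))\<^sup>2)" for z
  have P[measurable]: "P \<in> borel \<rightarrow>\<^sub>M borel" unfolding P_def using \<psi>m by measurable
  define r where "r = 1 / sqrt k"
  have r: "r > 0" "k * r\<^sup>2 = 1" using k by (simp_all add: r_def power_divide)
  define v where "v = unit_ball_vol (real (2 * CARD('n))) * r ^ (2 * CARD('n))"
  have v: "v > 0" using r unfolding v_def by (intro mult_pos_pos unit_ball_vol_pos zero_less_power) auto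
  have vol: "emeasure lborel (cball 0 r :: (complex ^ 'n) set) = ennreal v"
    using r emeasure_cball[of r "0 :: complex ^ 'n"] by (simp add: v_def mult.commute)
  have [measurable]: "(\<lambda>(w, z :: complex ^ 'n). indicator (cball w r) z :: ennreal) \<in> borel_measurable (borel \<Otimes>\<^sub>M borel)"
    by (simp add: indicator_def case_prod_beta)
  have "ennreal v * (\<integral>\<^sup>+w. P w \<partial>\<mu>) = (\<integral>\<^sup>+w. ennreal v * P w \<partial>\<mu>)"
    by (rule nn_integral_cmult[symmetric]) measurable
  also have "\<dots> \<le> (\<integral>\<^sup>+w. ennreal (exp 1) * (\<integral>\<^sup>+z. P z * indicator (cball w r) z \<partial>lborel) \<partial>\<mu>)"
    using bargmann_local_bound[OF \<psi>, of _ r] k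
    by (intro nn_integral_mono) (simp add: P_def r vol mult.commute)
  also have "\<dots> = ennreal (exp 1) * (\<integral>\<^sup>+w. (\<integral>\<^sup>+z. P z * indicator (cball w r) z \<partial>lborel) \<partial>\<mu>)"
    by (rule nn_integral_cmult) measurable
  also have "(\<integral>\<^sup>+w. (\<integral>\<^sup>+z. P z * indicator (cball w r) z \<partial>lborel) \<partial>\<mu>)
    = (\<integral>\<^sup>+z. (\<integral>\<^sup>+w. P z * indicator (cball w r) z \<partial>\<mu>) \<partial>lborel)"
    by (rule P.Fubini'[symmetric]) measurable
  also have "\<dots> = (\<integral>\<^sup>+z. P z * emeasure \<mu> (cball z r) \<partial>lborel)"
  proof (rule nn_integral_cong)
    fix z
    have "(\<integral>\<^sup>+w. P z * indicator (cball w r) z \<partial>\<mu>) = (\<integral>\<^sup>+w. P z * indicator (cball z r) w \<partial>\<mu>)"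
      by (intro nn_integral_cong) (simp add: indicator_def dist_commute)
    also have "\<dots> = P z * emeasure \<mu> (cball z r)"
      by (rule nn_integral_cmult_indicator) (simp add: sets\<mu>)
    finally show "(\<integral>\<^sup>+w. P z * indicator (cball w r) z \<partial>\<mu>) = P z * emeasure \<mu> (cball z r)" .
  qed
  also have "\<dots> \<le> (\<integral>\<^sup>+z. ennreal (C * r ^ d) * P z \<partial>lborel)"
    by (subst mult.commute) (intro nn_integral_mono mult_right_mono growth r, simp)
  also have "\<dots> = ennreal (C * r ^ d) * (\<integral>\<^sup>+z. P z \<partial>lborel)"
    by (rule nn_integral_cmult) measurable
  finally have "ennreal (1 / v) * (ennreal v * (\<integral>\<^sup>+w. P w \<partial>\<mu>))
      \<le> ennreal (1 / v) * (ennreal (exp 1) * (ennreal (C * r ^ d) * (\<integral>\<^sup>+z. P z \<partial>lborel)))"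
    by (simp add: mult_left_mono)
  also have "ennreal (1 / v) * (ennreal v * (\<integral>\<^sup>+w. P w \<partial>\<mu>)) = (\<integral>\<^sup>+w. P w \<partial>\<mu>)"
    using v by (simp add: mult.assoc[symmetric] ennreal_mult[symmetric])
  also have "ennreal (1 / v) * (ennreal (exp 1) * (ennreal (C * r ^ d) * (\<integral>\<^sup>+z. P z \<partial>lborel)))
    = ennreal (1 / v * exp 1 * (C * r ^ d)) * (\<integral>\<^sup>+z. P z \<partial>lborel)"
    using v C r by (intro ennreal_mult_collect3) simp_all
  also have "1 / v * exp 1 * (C * r ^ d)
    = exp 1 / unit_ball_vol (real (2 * CARD('n))) * C * (r ^ d / r ^ (2 * CARD('n)))"
    unfolding v_def by simp
  also have "r ^ d / r ^ (2 * CARD('n)) = k powr (real CARD('n) - real d / 2)"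
    unfolding r_def inverse_sqrt_power[OF k] by (simp add: powr_diff[symmetric] algebra_simps)
  finally show ?thesis by (simp only: P_def)
qed

text \<open>The Schur test, followed by the Carleson embedding to return from \<open>\<mu>\<close> to Lebesgue measure.  The
columns are estimated by the same lemma as the rows, since Lebesgue measure itself has growth of
order \<open>2 * N\<close>.\<close>

lemma gaussian_smoothing_bound:
  fixes \<mu> :: "(complex ^ 'n) measure"
  assumes "sigma_finite_measure \<mu>" and sets\<mu>[measurable_cong]: "sets \<mu> = sets borel"
    and C: "C \<ge> 0" and k: "k > 0"
    and growth: "\<And>z r. r > 0 \<Longrightarrow> emeasure \<mu> (cball z r) \<le> ennreal (C * r ^ d)"
    and \<psi>: "\<psi> \<in> bargmann_space k"
  shows "(\<integral>\<^sup>+z. (\<integral>\<^sup>+w. ennreal (exp (- (k * (dist z w)\<^sup>2 / 2)) * cmod (\<psi> w)) \<partial>\<mu>)\<^sup>2 \<partial>lborel)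
    \<le> ennreal (exp 1 * shell_sum d * shell_sum (2 * CARD('n)) * C\<^sup>2 * k powr (- real d))
       * (\<integral>\<^sup>+z. ennreal ((cmod (\<psi> z))\<^sup>2) \<partial>lborel)"
proof -
  let ?N = "CARD('n)"
  let ?v = "unit_ball_vol (real (2 * ?N))"
  let ?e = "\<lambda>(z :: complex ^ 'n) w. ennreal (exp (- (k * (dist z w)\<^sup>2 / 4)))"
  let ?S = "C * shell_sum d * k powr (- (real d / 2))"
  let ?G = "?v * shell_sum (2 * ?N) * k powr (- real ?N)"
  have v: "?v > 0" by simp
  \<comment> \<open>The ball volume enters once as growth constant and once, inverted, from the embedding.\<close>
  have cancel: "C * a * p * (V * b * q) * (exp 1 / V * C * s) = exp 1 * a * b * C\<^sup>2 * (p * q * s)"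
    if "V \<noteq> 0" for V a b p q s :: real
    using that by (simp add: power2_eq_square)
  have S: "?S \<ge> 0" and G: "?G \<ge> 0"
    using C v shell_sum_nonneg[of d] shell_sum_nonneg[of "2 * ?N"] by (simp_all add: less_imp_le)
  have [measurable]: "\<psi> \<in> borel \<rightarrow>\<^sub>M borel"
    using bargmann_space_continuous[OF \<psi>] by (rule borel_measurable_continuous_onI)
  have sq: "(?e z w)\<^sup>2 = ennreal (exp (- (k * (dist z w)\<^sup>2 / 2)))" for z w
    by (simp add: ennreal_power flip: exp_double)
  have "(\<integral>\<^sup>+z. (\<integral>\<^sup>+w. (?e z w)\<^sup>2 * ennreal (cmod (\<psi> w)) \<partial>\<mu>)\<^sup>2 \<partial>lborel)
    \<le> ennreal ?S * (ennreal ?G * (\<integral>\<^sup>+w. (ennreal (cmod (\<psi> w)))\<^sup>2 \<partial>\<mu>))"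
  proof (rule schur_test)
    show "sigma_finite_measure \<mu>" by fact
    show "sigma_finite_measure (lborel :: (complex ^ 'n) measure)" by (rule sigma_finite_lborel)
    show "(\<lambda>(x, y). ?e x y) \<in> borel_measurable (lborel \<Otimes>\<^sub>M \<mu>)" by measurable
    show "(\<lambda>w. ennreal (cmod (\<psi> w))) \<in> borel_measurable \<mu>" by measurable
    show "(\<integral>\<^sup>+w. (?e z w)\<^sup>2 \<partial>\<mu>) \<le> ennreal ?S" for z
      unfolding sq by (rule gaussian_integral_le[OF sets\<mu> C k growth])
    show "(\<integral>\<^sup>+z. (?e z w)\<^sup>2 \<partial>lborel) \<le> ennreal ?G" for w
      unfolding sq
      using gaussian_integral_le[of lborel ?v k w "2 * ?N"] v k
        emeasure_cball[of _ w] by (simp add: dist_commute mult.commute less_imp_le)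
  qed
  also have "(\<integral>\<^sup>+w. (ennreal (cmod (\<psi> w)))\<^sup>2 \<partial>\<mu>) = (\<integral>\<^sup>+w. ennreal ((cmod (\<psi> w))\<^sup>2) \<partial>\<mu>)"
    by (simp add: ennreal_power)
  also have "ennreal ?S * (ennreal ?G * \<dots>) \<le> ennreal ?S * (ennreal ?G *
     (ennreal (exp 1 / ?v * C * k powr (real ?N - real d / 2)) * (\<integral>\<^sup>+z. ennreal ((cmod (\<psi> z))\<^sup>2) \<partial>lborel)))"
    by (intro mult_left_mono bargmann_carleson assms) simp_all
  also have "\<dots> = ennreal (?S * ?G * (exp 1 / ?v * C * k powr (real ?N - real d / 2)))
     * (\<integral>\<^sup>+z. ennreal ((cmod (\<psi> z))\<^sup>2) \<partial>lborel)"
    by (rule ennreal_mult_collect3[OF S G]) (use C v in \<open>simp add: less_imp_le\<close>)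
  also have "?S * ?G * (exp 1 / ?v * C * k powr (real ?N - real d / 2))
    = exp 1 * shell_sum d * shell_sum (2 * ?N) * C\<^sup>2 *
      (k powr (- (real d / 2)) * k powr (- real ?N) * k powr (real ?N - real d / 2))"
    by (rule cancel) (rule less_imp_neq[OF v, THEN not_sym])
  also have "k powr (- (real d / 2)) * k powr (- real ?N) * k powr (real ?N - real d / 2) = k powr (- real d)"
    by (simp flip: powr_add)
  finally show ?thesis by (simp add: sq ennreal_mult)
qed



section \<open>Holomorphy of exponential integrals\<close>

text \<open>Differentiation under the integral sign.  On the bounded support of \<open>g\<close> the second-order
Taylor bound for \<open>exp\<close> is uniform, so the remainder of the linear approximation at \<open>z\<close> is
\<open>O((norm h)\<^sup>2)\<close> after integration.\<close>

lemma entire_exp_integral: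
  fixes g :: "complex ^ 'n \<Rightarrow> complex"
  assumes id[measurable]: "(\<lambda>w. w) \<in> \<sigma> \<rightarrow>\<^sub>M borel"
    and g: "integrable \<sigma> g" and supp: "\<And>w. R < norm w \<Longrightarrow> g w = 0" and R: "R \<ge> 0"
  shows "entire (\<lambda>z. LINT w|\<sigma>. exp (of_real k * herm z w) * g w)"
  unfolding entire_def
proof (intro allI)
  fix z :: "complex ^ 'n"
  let ?E = "\<lambda>w. exp (of_real k * herm z w)"
  have [measurable]: "g \<in> borel_measurable \<sigma>" using g by auto
  have herm[measurable]: "(\<lambda>w. herm x w) \<in> borel_measurable \<sigma>" for x :: "complex ^ 'n"
  proof -
    have "(\<lambda>w. herm x w) \<in> borel \<rightarrow>\<^sub>M borel"
      by (intro borel_measurable_continuous_onI continuous_intros)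
    from measurable_compose[OF id this] show ?thesis .
  qed
  have int: "integrable \<sigma> (\<lambda>w. c w * g w)"
    if [measurable]: "c \<in> borel_measurable \<sigma>" and B: "\<And>w. norm w \<le> R \<Longrightarrow> cmod (c w) \<le> B" for c B
  proof (rule Bochner_Integration.integrable_bound)
    show "integrable \<sigma> (\<lambda>w. of_real \<bar>B\<bar> * g w)" using g by simp
    show "AE w in \<sigma>. cmod (c w * g w) \<le> cmod (of_real \<bar>B\<bar> * g w)"
    proof (rule AE_I2)
      fix w
      show "cmod (c w * g w) \<le> cmod (of_real \<bar>B\<bar> * g w)"
        using B[of w] supp[of w]
        by (cases "norm w \<le> R") (auto simp: norm_mult intro!: mult_right_mono)
    qed
  qed measurable
  have herm_le: "cmod (of_real k * herm h w) \<le> \<bar>k\<bar> * R * norm h" if "norm w \<le> R" for h w :: "complex ^ 'n"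
    using norm_herm_le[of h w] mult_left_mono[OF that, of "norm h"]
    by (simp add: norm_mult mult.assoc mult_left_mono mult.commute[of R])
  have E_le: "cmod (exp (of_real k * herm x w)) \<le> exp (\<bar>k\<bar> * R * norm x)" if "norm w \<le> R" for x w :: "complex ^ 'n"
    by (rule order_trans[OF norm_exp]) (simp only: exp_le_cancel_iff herm_le[OF that])
  define D where "D h = (LINT w|\<sigma>. ?E w * (of_real k * herm h w) * g w)" for h
  define F where "F x = (LINT w|\<sigma>. exp (of_real k * herm x w) * g w)" for x
  have int_F: "integrable \<sigma> (\<lambda>w. exp (of_real k * herm x w) * g w)" for x
    by (rule int[OF _ E_le]) measurable
  have int_D: "integrable \<sigma> (\<lambda>w. ?E w * (of_real k * herm h w) * g w)" for h
    by (rule int[where B = "exp (\<bar>k\<bar> * R * norm z) * (\<bar>k\<bar> * R * norm h)"])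
      (measurable, simp only: norm_mult[of "?E _"], intro mult_mono E_le herm_le, simp_all)
  have smult: "D (c *s h) = c * D h" for c h
    by (simp add: D_def herm_smult_left mult_ac flip: integral_mult_right_zero)
  have "linear D"
  proof (rule linearI)
    show "D (x + y) = D x + D y" for x y
      using int_D[of x] int_D[of y] unfolding D_def herm_add_left
      by (subst Bochner_Integration.integral_add[symmetric]) (simp_all add: algebra_simps)
    show "D (c *\<^sub>R x) = c *\<^sub>R D x" for c x
      using smult[of "of_real c" x] by (simp add: scaleR_conv_of_real vector_scalar_mult_def scaleR_vec_def)
  qed
  define M where "M = exp (\<bar>k\<bar> * R * norm z) * (exp (\<bar>k\<bar> * R) * (\<bar>k\<bar> * R)\<^sup>2) * (LINT w|\<sigma>. cmod (g w))"
  have remainder: "cmod (F (z + h) - F z - D h) \<le> M * (norm h)\<^sup>2" if h: "norm h \<le> 1" for h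
  proof -
    let ?r = "\<lambda>w. ?E w * (exp (of_real k * herm h w) - 1 - of_real k * herm h w) * g w"
    have split: "?r w = exp (of_real k * herm (z + h) w) * g w - ?E w * g w
        - ?E w * (of_real k * herm h w) * g w" for w
      by (simp add: herm_add_left algebra_simps exp_add)
    have int_r: "integrable \<sigma> ?r"
      unfolding split using int_F int_D by auto
    have "F (z + h) - F z - D h = (LINT w|\<sigma>. ?r w)"
      unfolding F_def D_def split using int_F int_D by (simp add: Bochner_Integration.integral_diff)
    also have "cmod \<dots> \<le> (LINT w|\<sigma>. cmod (?r w))" by (rule integral_norm_bound)
    also have "\<dots> \<le> (LINT w|\<sigma>. (exp (\<bar>k\<bar> * R * norm z) * (exp (\<bar>k\<bar> * R) * ((\<bar>k\<bar> * R)\<^sup>2 * (norm h)\<^sup>2))) * cmod (g w))"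
    proof (rule integral_mono)
      show "integrable \<sigma> (\<lambda>w. cmod (?r w))" using int_r by (rule integrable_norm)
      show "integrable \<sigma> (\<lambda>w. (exp (\<bar>k\<bar> * R * norm z) * (exp (\<bar>k\<bar> * R) * ((\<bar>k\<bar> * R)\<^sup>2 * (norm h)\<^sup>2))) * cmod (g w))"
        using g by auto
      fix w
      show "cmod (?r w) \<le> (exp (\<bar>k\<bar> * R * norm z) * (exp (\<bar>k\<bar> * R) * ((\<bar>k\<bar> * R)\<^sup>2 * (norm h)\<^sup>2))) * cmod (g w)"
      proof (cases "norm w \<le> R")
        case True
        let ?x = "of_real k * herm h w"
        have x: "cmod ?x \<le> \<bar>k\<bar> * R * norm h" by (rule herm_le[OF True])
        have "cmod (exp ?x - 1 - ?x) \<le> exp (cmod ?x) * (cmod ?x)\<^sup>2"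
          using Taylor_exp_field[of ?x 1] by (simp add: power2_eq_square diff_diff_eq)
        also have "\<dots> \<le> exp (\<bar>k\<bar> * R) * (\<bar>k\<bar> * R * norm h)\<^sup>2"
          using x h R mult_left_mono[OF h, of "\<bar>k\<bar> * R"]
          by (intro mult_mono power_mono) auto
        finally have "cmod (exp ?x - 1 - ?x) \<le> exp (\<bar>k\<bar> * R) * ((\<bar>k\<bar> * R)\<^sup>2 * (norm h)\<^sup>2)"
          by (simp only: power_mult_distrib)
        then show ?thesis
          unfolding norm_mult[of _ "g w"] norm_mult[of "?E w"]
          by (intro mult_mono E_le True) simp_all
      qed (simp add: supp)
    qed
    also have "\<dots> = M * (norm h)\<^sup>2" by (simp add: M_def mult_ac)
    finally show ?thesis .
  qed
  have "(F has_derivative D) (at z)"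
  proof (rule has_derivativeI_sandwich[of 1])
    show "bounded_linear D" using \<open>linear D\<close> by (simp add: linear_conv_bounded_linear)
    show "((\<lambda>y. M * norm (y - z)) \<longlongrightarrow> 0) (at z)"
      by (rule tendsto_eq_intros refl | simp)+
    fix y assume y: "y \<noteq> z" "dist y z < 1"
    then have "cmod (F y - F z - D (y - z)) \<le> M * (norm (y - z))\<^sup>2"
      using remainder[of "y - z"] by (simp add: dist_norm)
    then show "cmod (F y - F z - D (y - z)) / norm (y - z) \<le> M * norm (y - z)"
      using y by (simp add: pos_divide_le_eq power2_eq_square mult.assoc)
  qed simp
  with smult show "\<exists>D. ((\<lambda>z. LINT w|\<sigma>. exp (of_real k * herm z w) * g w) has_derivative D) (at z) \<and>
      (\<forall>c v. D (c *s v) = c * D v)"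
    unfolding F_def by blast
qed



section \<open>Volume growth of compact pieces of a submanifold\<close>

lemma sets_plane_lborel [simp, measurable_cong]: "sets (plane_lborel B) = sets borel"
  by (simp add: plane_lborel_def)

text \<open>In the coordinates of the plane, the ball lies in a cube of side \<open>2 * r\<close>.\<close>

lemma plane_lborel_le_cube:
  fixes B :: "'a::euclidean_space set"
  assumes B: "B \<subseteq> Basis" and A: "A \<in> sets borel" "A \<subseteq> cball y r" and r: "r \<ge> 0"
  shows "emeasure (plane_lborel B) A \<le> ennreal ((2 * r) ^ card B)"
proof -
  interpret product_sigma_finite "\<lambda>b::'a. lborel :: real measure"
    by (simp add: product_sigma_finite_def sigma_finite_lborel)
  have fin: "finite B" using finite_subset[OF B finite_Basis] .
  let ?P = "\<Pi>\<^sub>M b\<in>B. (lborel :: real measure)"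
  let ?s = "\<lambda>x. \<Sum>b\<in>B. x b *\<^sub>R b :: 'a"
  have [measurable]: "?s \<in> ?P \<rightarrow>\<^sub>M borel" by measurable
  have coord: "?s x \<bullet> b = x b" if "b \<in> B" for x b
  proof -
    have "?s x \<bullet> b = (\<Sum>c\<in>B. if c = b then x c else 0)"
      unfolding inner_sum_left
      by (rule sum.cong) (use B that in \<open>auto simp: inner_Basis subset_iff\<close>)
    then show ?thesis using fin that by simp
  qed
  have "emeasure (plane_lborel B) A = emeasure ?P (?s -` A \<inter> space ?P)"
    unfolding plane_lborel_def by (rule emeasure_distr[OF _ A(1)]) fact
  also have "\<dots> \<le> emeasure ?P (Pi\<^sub>E B (\<lambda>b. {y \<bullet> b - r..y \<bullet> b + r}))"
  proof (rule emeasure_mono)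
    show "?s -` A \<inter> space ?P \<subseteq> Pi\<^sub>E B (\<lambda>b. {y \<bullet> b - r..y \<bullet> b + r})"
    proof
      fix x assume x: "x \<in> ?s -` A \<inter> space ?P"
      then have "?s x \<in> cball y r" 
        using subsetD[OF A(2), of "?s x"] by simp
      then have s: "norm (?s x - y) \<le> r"
        by (simp only: mem_cball dist_norm norm_minus_commute)
      have "x b \<in> {y \<bullet> b - r..y \<bullet> b + r}" if b: "b \<in> B" for b
      proof -
        have "\<bar>(?s x - y) \<bullet> b\<bar> \<le> r"
          using Basis_le_norm[of b "?s x - y"] B b s by (meson order_trans subsetD)
        then have "\<bar>x b - y \<bullet> b\<bar> \<le> r" by (simp only: inner_diff_left coord[OF b])
        then show ?thesis unfolding atLeastAtMost_iff by linarith
      qed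
      then show "x \<in> Pi\<^sub>E B (\<lambda>b. {y \<bullet> b - r..y \<bullet> b + r})"
        using x by (auto simp: space_PiM PiE_iff)
    qed
    show "Pi\<^sub>E B (\<lambda>b. {y \<bullet> b - r..y \<bullet> b + r}) \<in> sets ?P"
      using fin by (intro sets_PiM_I_finite) auto
  qed
  also have "\<dots> = (\<Prod>b\<in>B. emeasure lborel {y \<bullet> b - r..y \<bullet> b + r})"
    using fin by (intro emeasure_PiM) auto
  also have "\<dots> = ennreal ((2 * r) ^ card B)"
    using r by (simp add: ennreal_power)
  finally show ?thesis .
qed

lemma smooth_onD:
  assumes "smooth_on V f"
  shows "\<And>x. x \<in> V \<Longrightarrow> (f has_derivative frechet_derivative f (at x)) (at x)"
    and "\<And>v. continuous_on V (\<lambda>x. frechet_derivative f (at x) v)"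
proof -
  have "Ck_on (Suc 0) V f" using assms unfolding smooth_on_def by (rule spec)
  then show "\<And>x. x \<in> V \<Longrightarrow> (f has_derivative frechet_derivative f (at x)) (at x)"
    "\<And>v. continuous_on V (\<lambda>x. frechet_derivative f (at x) v)"
    by (simp_all add: frechet_derivative_works)
qed

text \<open>Smoothness provides continuity of each directional derivative; the sum of their norms over the basis is a continuous bound for the operator norm, hence bounded on a compact set.\<close>

lemma smooth_on_lipschitz:
  fixes f :: "'a::euclidean_space \<Rightarrow> 'b::real_normed_vector"
  assumes f: "smooth_on V f" and Q: "compact Q" "convex Q" "Q \<subseteq> V"
  obtains L where "L \<ge> 0" "\<And>x y. x \<in> Q \<Longrightarrow> y \<in> Q \<Longrightarrow> dist (f x) (f y) \<le> L * dist x y"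
proof -
  let ?f' = "\<lambda>x. frechet_derivative f (at x)"
  have "continuous_on Q (\<lambda>x. \<Sum>b\<in>Basis. norm (?f' x b))"
    by (intro continuous_intros continuous_on_subset[OF smooth_onD(2)[OF f]] Q)
  then have "bounded ((\<lambda>x. \<Sum>b\<in>Basis. norm (?f' x b)) ` Q)"
    by (intro compact_imp_bounded compact_continuous_image Q)
  then obtain L where "L > 0" "\<forall>y\<in>(\<lambda>x. \<Sum>b\<in>Basis. norm (?f' x b)) ` Q. norm y \<le> L"
    unfolding bounded_pos by blast
  then have L: "L > 0" "\<And>x. x \<in> Q \<Longrightarrow> (\<Sum>b\<in>Basis. norm (?f' x b)) \<le> L"
    by (auto simp: abs_le_iff)
  have der: "(f has_derivative ?f' x) (at x within Q)" if "x \<in> Q" for x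
    by (rule has_derivative_at_withinI[OF smooth_onD(1)[OF f subsetD[OF Q(3) that]]])
  have onorm: "onorm (?f' x) \<le> L" if x: "x \<in> Q" for x
  proof (rule onorm_bound)
    interpret bounded_linear "?f' x" using der[OF x] by (rule has_derivative_bounded_linear)
    fix h
    have "?f' x h = (\<Sum>b\<in>Basis. (h \<bullet> b) *\<^sub>R ?f' x b)"
      by (subst euclidean_representation[symmetric, of h]) (simp only: sum scaleR)
    also have "norm \<dots> \<le> (\<Sum>b\<in>Basis. norm h * norm (?f' x b))"
      by (rule order_trans[OF norm_sum])
        (auto intro!: sum_mono mult_right_mono Basis_le_norm)
    also have "\<dots> \<le> L * norm h"
      unfolding sum_distrib_left[symmetric] mult.commute[of L]
      by (rule mult_left_mono[OF L(2)[OF x] norm_ge_zero])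
    finally show "norm (?f' x h) \<le> L * norm h" .
  qed (use L in simp)
  have "norm (f x - f y) \<le> L * norm (x - y)" if "x \<in> Q" "y \<in> Q" for x y
    by (rule differentiable_bound[OF Q(2) der onorm that])
  then show thesis using that[of L] L(1) by (simp add: dist_norm)
qed

text \<open>Pull \<open>M \<inter> cball p \<epsilon> \<inter> cball z r\<close> back through the chart.  The inverse chart is Lipschitz on the
(convex) ball about \<open>p\<close>, so the preimage has diameter at most \<open>2 * L * r\<close> and lies in a ball of
that radius; its \<open>d\<close>-dimensional volume is therefore \<open>O(r ^ d)\<close>, and the Gram density is bounded on the
compact preimage of the ball.\<close>

lemma slice_chart_growth:
  fixes \<sigma> :: "'a::euclidean_space measure"
  assumes \<sigma>: "riemannian_volume d M \<sigma>" and chart: "slice_chart d M B V \<phi>" and p: "p \<in> \<phi> ` V"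
  obtains \<epsilon> C where "\<epsilon> > 0" "C \<ge> 0"
    "\<And>z r. r > 0 \<Longrightarrow> emeasure \<sigma> (M \<inter> cball p \<epsilon> \<inter> cball z r) \<le> ennreal (C * r ^ d)"
proof -
  from chart obtain \<psi> where B: "B \<subseteq> Basis" "card B = d" and V: "open V" "open (\<phi> ` V)"
    and hom: "homeomorphism V (\<phi> ` V) \<phi> \<psi>"
    and smooth: "smooth_on V \<phi>" "smooth_on (\<phi> ` V) \<psi>"
    and slice: "\<phi> ` (V \<inter> span B) = M \<inter> \<phi> ` V"
    unfolding slice_chart_def by blast
  have \<psi>\<phi>: "\<psi> (\<phi> x) = x" if "x \<in> V" for x
    using hom that by (rule homeomorphism_apply1)
  have \<phi>\<psi>: "\<phi> (\<psi> y) = y" if "y \<in> \<phi> ` V" for y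
    using hom that by (rule homeomorphism_apply2)
  obtain \<epsilon> where \<epsilon>: "\<epsilon> > 0" and sub: "cball p \<epsilon> \<subseteq> \<phi> ` V"
    using V(2) p open_contains_cball by blast
  define Q where "Q = cball p \<epsilon>"
  have Q: "compact Q" "convex Q" "Q \<subseteq> \<phi> ` V" using sub by (simp_all add: Q_def)
  obtain L where L: "L \<ge> 0" "\<And>x y. x \<in> Q \<Longrightarrow> y \<in> Q \<Longrightarrow> dist (\<psi> x) (\<psi> y) \<le> L * dist x y"
    using smooth_on_lipschitz[OF smooth(2) Q] by blast
  have cont\<psi>: "continuous_on Q \<psi>"
    using continuous_on_subset[OF homeomorphism_cont2[OF hom] Q(3)] .
  have \<psi>Q: "\<psi> ` Q \<subseteq> V"
    using homeomorphism_image2[OF hom] Q(3) by blast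
  let ?J = "\<lambda>x. sqrt (gram_det B (frechet_derivative \<phi> (at x)))"
  have "continuous_on (\<psi> ` Q) ?J"
    unfolding gram_det_def
    by (intro continuous_intros continuous_on_subset[OF smooth_onD(2)[OF smooth(1)] \<psi>Q])
  then have "bounded (?J ` \<psi> ` Q)"
    by (intro compact_imp_bounded compact_continuous_image cont\<psi> Q)
  then obtain G where G: "G > 0" "\<And>x. x \<in> \<psi> ` Q \<Longrightarrow> \<bar>?J x\<bar> \<le> G"
    by (auto simp: bounded_pos)
  show thesis
  proof (rule that[of \<epsilon> "G * (4 * L) ^ d"])
    fix z :: 'a and r :: real assume r: "r > 0"
    \<comment> \<open>As a compact set intersected with a plane, \<open>A\<close> is Borel.\<close>
    define A where "A = \<psi> ` (Q \<inter> cball z r) \<inter> span B"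
    have "compact (\<psi> ` (Q \<inter> cball z r))"
      by (intro compact_continuous_image continuous_on_subset[OF cont\<psi>] compact_Int_closed Q) auto
    then have A: "A \<in> sets borel"
      unfolding A_def by (intro sets.Int borel_compact borel_closed closed_span)
    have AV: "A \<subseteq> V \<inter> span B" using \<psi>Q by (auto simp: A_def)
    have "\<phi> ` A = M \<inter> cball p \<epsilon> \<inter> cball z r"
    proof (intro equalityI subsetI)
      fix q assume "q \<in> \<phi> ` A"
      then obtain q' where q': "q' \<in> Q" "q' \<in> cball z r" "\<psi> q' \<in> span B" "q = \<phi> (\<psi> q')"
        by (auto simp: A_def)
      then have "q = q'" using \<phi>\<psi>[of q'] Q(3) by auto
      moreover have "\<psi> q' \<in> V \<inter> span B" using q' \<psi>Q by auto
      then have "q \<in> \<phi> ` (V \<inter> span B)" unfolding q'(4) by (rule imageI)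
      then have "q \<in> M" unfolding slice by simp
      ultimately show "q \<in> M \<inter> cball p \<epsilon> \<inter> cball z r" using q' by (simp add: Q_def)
    next
      fix q assume q: "q \<in> M \<inter> cball p \<epsilon> \<inter> cball z r"
      then have "q \<in> M \<inter> \<phi> ` V" using sub by blast
      then have "q \<in> \<phi> ` (V \<inter> span B)" unfolding slice .
      then obtain x where x: "x \<in> V" "x \<in> span B" "q = \<phi> x" by blast
      then have "x = \<psi> q" using \<psi>\<phi> by simp
      then show "q \<in> \<phi> ` A" using x q by (auto simp: A_def Q_def)
    qed
    then have "emeasure \<sigma> (M \<inter> cball p \<epsilon> \<inter> cball z r) = emeasure \<sigma> (\<phi> ` A)"
      by (simp only:)
    also have "\<dots> = (\<integral>\<^sup>+x\<in>A. ennreal (?J x) \<partial>plane_lborel B)"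
      using \<sigma>[unfolded riemannian_volume_def, THEN conjunct2, rule_format, OF chart A AV] .
    also have "\<dots> \<le> (\<integral>\<^sup>+x. ennreal G * indicator A x \<partial>plane_lborel B)"
    proof (rule nn_integral_mono)
      fix x
      show "ennreal (?J x) * indicator A x \<le> ennreal G * indicator A x"
        using G(2)[of x] by (auto simp: indicator_def A_def intro!: ennreal_leI)
    qed
    also have "\<dots> = ennreal G * emeasure (plane_lborel B) A"
      using A by (simp add: nn_integral_cmult_indicator)
    also have "\<dots> \<le> ennreal G * ennreal ((2 * (L * (2 * r))) ^ d)"
    proof (cases "A = {}")
      case False
      then obtain q where q: "q \<in> Q" "q \<in> cball z r" by (auto simp: A_def)
      have "A \<subseteq> cball (\<psi> q) (L * (2 * r))"
      proof
        fix x assume "x \<in> A"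
        then obtain q' where q': "q' \<in> Q" "q' \<in> cball z r" "x = \<psi> q'" by (auto simp: A_def)
        have "dist q q' \<le> 2 * r"
          using q(2) q'(2) dist_triangle3[of q q' z] by auto
        then have "L * dist q q' \<le> L * (2 * r)" using L(1) by (rule mult_left_mono)
        then show "x \<in> cball (\<psi> q) (L * (2 * r))"
          using L(2)[OF q(1) q'(1)] q'(3) by auto
      qed
      then show ?thesis
        using plane_lborel_le_cube[OF B(1) A, of "\<psi> q" "L * (2 * r)"] L(1) r
        unfolding B(2) by (intro mult_left_mono) simp_all
    qed simp
    also have "\<dots> = ennreal (G * (4 * L) ^ d * r ^ d)"
    proof -
      have "2 * (L * (2 * r)) = 4 * L * r" by simp
      then have "(2 * (L * (2 * r))) ^ d = (4 * L) ^ d * r ^ d"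
        by (simp only: power_mult_distrib)
      then show ?thesis
        using G(1) L(1) r by (simp only: mult.assoc) (simp add: ennreal_mult)
    qed
    finally show "emeasure \<sigma> (M \<inter> cball p \<epsilon> \<inter> cball z r) \<le> ennreal (G * (4 * L) ^ d * r ^ d)" .
  qed (use \<epsilon> G L in auto)
qed

text \<open>Sum the local constants over a finite cover by chart neighbourhoods.\<close>

lemma compact_submanifold_growth:
  fixes \<sigma> :: "'a::euclidean_space measure"
  assumes M: "smooth_submanifold d M" and \<sigma>: "riemannian_volume d M \<sigma>"
    and K: "compact K" "K \<subseteq> M"
  obtains C where "C \<ge> 0" "\<And>z r. r > 0 \<Longrightarrow> emeasure \<sigma> (K \<inter> cball z r) \<le> ennreal (C * r ^ d)"
proof -
  have sets: "M \<inter> A \<in> sets \<sigma>" if "A \<in> sets borel" for A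
    unfolding \<sigma>[unfolded riemannian_volume_def, THEN conjunct1] sets_restrict_space
    using that by (rule imageI)
  define good where "good p \<epsilon> C \<longleftrightarrow> \<epsilon> > 0 \<and> C \<ge> 0 \<and>
      (\<forall>z r. r > 0 \<longrightarrow> emeasure \<sigma> (M \<inter> cball p \<epsilon> \<inter> cball z r) \<le> ennreal (C * r ^ d))" for p \<epsilon> C
  have "\<exists>\<epsilon> C. good p \<epsilon> C" if pK: "p \<in> K" for p
  proof -
    obtain B V \<phi> where "slice_chart d M B V \<phi>" "p \<in> \<phi> ` V"
      using M K pK unfolding smooth_submanifold_def by (meson subsetD)
    then show ?thesis
      by (rule slice_chart_growth[OF \<sigma>]) (unfold good_def, blast)
  qed
  then obtain \<epsilon> C where good: "\<And>p. p \<in> K \<Longrightarrow> good p (\<epsilon> p) (C p)"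
    by metis
  note \<epsilon> = good[unfolded good_def, THEN conjunct1]
  note C = good[unfolded good_def, THEN conjunct2, THEN conjunct1]
  note le = good[unfolded good_def, THEN conjunct2, THEN conjunct2, rule_format]
  have "K \<subseteq> (\<Union>p\<in>K. ball p (\<epsilon> p))"
  proof
    fix p assume "p \<in> K"
    then show "p \<in> (\<Union>p\<in>K. ball p (\<epsilon> p))" using \<epsilon>[of p] by (intro UN_I[of p]) simp_all
  qed
  then obtain F where F: "F \<subseteq> K" "finite F" "K \<subseteq> (\<Union>p\<in>F. ball p (\<epsilon> p))"
    using compactE_image[OF K(1), of K "\<lambda>p. ball p (\<epsilon> p)"] by auto
  show thesis
  proof (rule that[of "\<Sum>p\<in>F. C p"])
    show "0 \<le> (\<Sum>p\<in>F. C p)" using C F by (intro sum_nonneg) auto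
    fix z :: 'a and r :: real assume r: "r > 0"
    let ?A = "\<lambda>p. M \<inter> cball p (\<epsilon> p) \<inter> cball z r"
    have A: "?A p \<in> sets \<sigma>" for p using sets[of "cball p (\<epsilon> p) \<inter> cball z r"] by (simp add: Int_assoc)
    have "emeasure \<sigma> (K \<inter> cball z r) \<le> emeasure \<sigma> (\<Union>p\<in>F. ?A p)"
    proof (rule emeasure_mono)
      have "(\<Union>p\<in>F. ball p (\<epsilon> p)) \<subseteq> (\<Union>p\<in>F. cball p (\<epsilon> p))"
        by (intro UN_mono ball_subset_cball) simp
      from order_trans[OF F(3) this] have cover: "K \<subseteq> (\<Union>p\<in>F. cball p (\<epsilon> p))" .
      show "K \<inter> cball z r \<subseteq> (\<Union>p\<in>F. ?A p)"
      proof
        fix x assume x: "x \<in> K \<inter> cball z r"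
        then obtain p where "p \<in> F" "x \<in> cball p (\<epsilon> p)" using cover by (meson IntD1 UN_E subsetD)
        then show "x \<in> (\<Union>p\<in>F. ?A p)" using x subsetD[OF K(2)] by (intro UN_I[of p]) simp_all
      qed
      show "(\<Union>p\<in>F. ?A p) \<in> sets \<sigma>" by (rule sets.finite_UN[OF F(2) A])
    qed
    also have "\<dots> \<le> (\<Sum>p\<in>F. emeasure \<sigma> (?A p))"
      using F(2) A by (intro emeasure_subadditive_finite) auto
    also have "\<dots> \<le> (\<Sum>p\<in>F. ennreal (C p * r ^ d))"
      using F(1) le r by (intro sum_mono) auto
    also have "\<dots> = ennreal ((\<Sum>p\<in>F. C p) * r ^ d)"
      using F(1) C r by (subst sum_ennreal) (auto simp: sum_distrib_right)
    finally show "emeasure \<sigma> (K \<inter> cball z r) \<le> ennreal ((\<Sum>p\<in>F. C p) * r ^ d)" .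
  qed
qed



section \<open>Toeplitz operators with compactly supported symbol\<close>

lemma bargmann_kernel_factor:
  "bargmann_kernel k z w = exp (of_real k * herm z w)
     * (of_real ((k / pi) ^ CARD('n)) * exp (- of_real (k * (norm w)\<^sup>2 / 2)))
     * exp (- of_real (k * (norm z)\<^sup>2 / 2))" for z w :: "complex ^ 'n"
proof -
  have "exp (x - y - v) = exp x * exp (- y) * exp (- v)" for x y v :: complex
    by (simp add: exp_diff exp_minus divide_inverse)
  then show ?thesis
    unfolding bargmann_kernel_def herm_def by (simp only: mult_ac)
qed

text \<open>All three conclusions rest on the Borel measure \<open>\<mu>\<close> on the whole space given by \<open>\<sigma>\<close> restricted to \<open>K\<close>:
it is finite and inherits the growth bound, so \<open>gaussian_smoothing_bound\<close> applies to it.  Pointwise,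
\<open>cmod (T \<psi> z)\<close> is at most \<open>(k / pi) ^ N * A\<close> times the Gaussian smoothing of \<open>cmod \<psi>\<close>.\<close>

lemma toeplitz_bound:
  fixes \<sigma> :: "(complex ^ 'n) measure"
  assumes id[measurable]: "(\<lambda>w. w) \<in> \<sigma> \<rightarrow>\<^sub>M borel"
    and K: "compact K" "K \<in> sets \<sigma>" and C: "C \<ge> 0"
    and growth: "\<And>z r. r > 0 \<Longrightarrow> emeasure \<sigma> (K \<inter> cball z r) \<le> ennreal (C * r ^ d)"
    and a[measurable]: "a \<in> borel_measurable \<sigma>"
    and A: "A \<ge> 0" "AE w in \<sigma>. cmod (a w) \<le> A" "AE w in \<sigma>. w \<notin> K \<longrightarrow> a w = 0"
    and k: "k > 0" and \<psi>: "\<psi> \<in> bargmann_space k"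
  shows "integrable \<sigma> (toeplitz_integrand k a \<psi> z)"
    and "toeplitz k \<sigma> a \<psi> \<in> bargmann_space k"
    and "L2_norm (toeplitz k \<sigma> a \<psi>)
      \<le> sqrt (exp 1 * shell_sum d * shell_sum (2 * CARD('n))) * C / pi ^ CARD('n)
         * A * k powr (real CARD('n) - real d / 2) * L2_norm \<psi>"
proof -
  let ?N = "CARD('n)"
  let ?T = "toeplitz k \<sigma> a \<psi>"
  define \<mu> where "\<mu> = distr (density \<sigma> (indicator K)) borel (\<lambda>w. w)"
  have sets\<mu>: "sets \<mu> = sets borel" by (simp add: \<mu>_def)
  have id': "(\<lambda>w. w) \<in> density \<sigma> (indicator K) \<rightarrow>\<^sub>M borel" using id by simp
  have nn\<mu>: "(\<integral>\<^sup>+w. f w \<partial>\<mu>) = (\<integral>\<^sup>+w. f w * indicator K w \<partial>\<sigma>)"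
    if [measurable]: "f \<in> borel \<rightarrow>\<^sub>M borel" for f :: "_ \<Rightarrow> ennreal"
  proof -
    have [measurable]: "f \<in> borel_measurable \<sigma>"
      using measurable_compose[OF id that] .
    show ?thesis
      unfolding \<mu>_def using K(2)
      by (subst nn_integral_distr[OF id'], simp add: that, subst nn_integral_density)
        (simp_all add: mult.commute)
  qed
  have em\<mu>: "emeasure \<mu> S = emeasure \<sigma> (K \<inter> S)" if S: "S \<in> sets borel" for S
  proof -
    have "S \<inter> space \<sigma> \<in> sets \<sigma>" using measurable_sets[OF id S] by simp
    then have KS: "K \<inter> S \<in> sets \<sigma>"
      using sets.Int[OF K(2), of "S \<inter> space \<sigma>"] sets.sets_into_space[OF K(2)] 
      by (metis Int_absorb2 Int_assoc Int_commute)
    have "emeasure \<mu> S = (\<integral>\<^sup>+w. indicator S w \<partial>\<mu>)" using S sets\<mu> by simp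
    also have "\<dots> = (\<integral>\<^sup>+w. indicator S w * indicator K w \<partial>\<sigma>)"
      using S by (intro nn\<mu>) simp
    also have "\<dots> = (\<integral>\<^sup>+w. indicator (K \<inter> S) w \<partial>\<sigma>)"
      by (simp only: indicator_inter_arith mult.commute)
    finally show ?thesis using KS by simp
  qed
  obtain R where "R > 0" "\<forall>w\<in>K. norm w \<le> R"
    using compact_imp_bounded[OF K(1)] unfolding bounded_pos by blast
  then have R: "R > 0" "K \<subseteq> cball 0 R" by auto
  have "K \<inter> cball 0 R = K" using R(2) by (rule Int_absorb2)
  then have finK: "emeasure \<sigma> K < \<infinity>"
    using growth[OF R(1), of 0] by (simp add: le_less_trans[OF _ ennreal_less_top])
  have fin\<mu>: "finite_measure \<mu>"
    by (rule finite_measureI) (use em\<mu>[of UNIV] finK sets_eq_imp_space_eq[OF sets\<mu>] in simp)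
  then have sf: "sigma_finite_measure \<mu>" by (rule finite_measure.axioms)
  have growth\<mu>: "emeasure \<mu> (cball z r) \<le> ennreal (C * r ^ d)" if "r > 0" for z r
    using growth[OF that] by (simp add: em\<mu>)

  have \<psi>c: "continuous_on S \<psi>" for S using \<psi> by (rule bargmann_space_continuous)
  have \<psi>b: "\<psi> \<in> borel \<rightarrow>\<^sub>M borel" using \<psi>c by (rule borel_measurable_continuous_onI)
  then have [measurable]: "\<psi> \<in> borel_measurable \<sigma>" using measurable_compose[OF id] by blast
  \<comment> \<open>On \<open>K\<close>, of finite measure, \<open>u\<close> is bounded by continuity; outside \<open>K\<close>, \<open>a\<close> vanishes.\<close>
  have int: "integrable \<sigma> (\<lambda>w. u w * a w)" if u: "continuous_on UNIV u" for u :: "complex ^ 'n \<Rightarrow> complex"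
  proof -
    have "compact (u ` K)" using K(1) u by (meson compact_continuous_image continuous_on_subset subset_UNIV)
    then obtain B where B: "\<And>w. w \<in> K \<Longrightarrow> cmod (u w) \<le> B"
      using compact_imp_bounded bounded_iff by (metis imageI)
    have [measurable]: "u \<in> borel_measurable \<sigma>"
      using measurable_compose[OF id borel_measurable_continuous_onI[OF u]] .
    show ?thesis
    proof (rule integrableI_bounded_set[OF K(2) _ finK])
      show "AE w in \<sigma>. w \<in> K \<longrightarrow> norm (u w * a w) \<le> \<bar>B\<bar> * A"
        using A(2)
      proof eventually_elim
        case (elim w)
        show ?case
        proof
          assume "w \<in> K"
          then show "norm (u w * a w) \<le> \<bar>B\<bar> * A"
            unfolding norm_mult using elim A(1) B[of w] by (intro mult_mono) auto
        qed
      qed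
      show "AE w in \<sigma>. w \<notin> K \<longrightarrow> u w * a w = 0"
        using A(3) by eventually_elim simp
    qed measurable
  qed
  have kc: "continuous_on UNIV (\<lambda>w. bargmann_kernel k z w * \<psi> w)" for z
    unfolding bargmann_kernel_def by (intro continuous_intros \<psi>c) simp
  show int_T: "integrable \<sigma> (toeplitz_integrand k a \<psi> z)" for z
    unfolding toeplitz_integrand_def by (rule int[OF kc])

  define g where "g w = of_real ((k / pi) ^ ?N) * exp (- of_real (k * (norm w)\<^sup>2 / 2)) * \<psi> w * a w" for w
  \<comment> \<open>The indicator makes the density vanish everywhere outside a ball, not just almost everywhere.\<close>
  define F where "F z = (LINT w|\<sigma>. exp (of_real k * herm z w) * (indicator K w *\<^sub>R g w))" for z
  have int_g: "integrable \<sigma> g"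
    unfolding g_def by (intro int continuous_intros \<psi>c) simp
  then have int_gK: "integrable \<sigma> (\<lambda>w. indicator K w *\<^sub>R g w)"
    using K(2) by (intro integrable_mult_indicator)
  have "entire F"
    unfolding F_def
  proof (rule entire_exp_integral[OF id int_gK])
    fix w :: "complex ^ 'n" assume "R < norm w"
    then have "w \<notin> K" using subsetD[OF R(2), of w] by auto
    then show "indicator K w *\<^sub>R g w = 0" by simp
  qed (use R(1) in simp)
  have T_F: "?T z = F z * exp (complex_of_real (- k * (norm z)\<^sup>2 / 2))" for z
  proof -
    have [measurable]: "(\<lambda>w. herm z w) \<in> borel_measurable \<sigma>"
      by (rule measurable_compose[OF id]) (intro borel_measurable_continuous_onI continuous_intros)
    have [measurable]: "g \<in> borel_measurable \<sigma>" using int_g by auto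
    have "?T z = (LINT w|\<sigma>. exp (of_real k * herm z w) * (indicator K w *\<^sub>R g w)
        * exp (- of_real (k * (norm z)\<^sup>2 / 2)))"
      unfolding toeplitz_def
    proof (rule integral_cong_AE)
      show "toeplitz_integrand k a \<psi> z \<in> borel_measurable \<sigma>" using int_T by auto
      show "(\<lambda>w. exp (of_real k * herm z w) * (indicator K w *\<^sub>R g w)
        * exp (- of_real (k * (norm z)\<^sup>2 / 2))) \<in> borel_measurable \<sigma>"
        using K(2) by measurable
      show "AE w in \<sigma>. toeplitz_integrand k a \<psi> z w
        = exp (of_real k * herm z w) * (indicator K w *\<^sub>R g w) * exp (- of_real (k * (norm z)\<^sup>2 / 2))"
        using A(3)
      proof eventually_elim
        case (elim w)
        then show ?case
          unfolding toeplitz_integrand_def bargmann_kernel_factor g_def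
          by (cases "w \<in> K") (simp_all add: mult_ac)
      qed
    qed
    also have "\<dots> = F z * exp (- of_real (k * (norm z)\<^sup>2 / 2))"
      unfolding F_def by (rule integral_mult_left_zero)
    finally show ?thesis by simp
  qed
  have Tc: "continuous_on UNIV ?T"
    unfolding T_F[abs_def] using entire_continuous_on[OF \<open>entire F\<close>, of UNIV]
    by (intro continuous_intros) simp_all
  then have [measurable]: "?T \<in> borel \<rightarrow>\<^sub>M borel" by (rule borel_measurable_continuous_onI)

  let ?q = "(k / pi) ^ ?N * A"
  let ?I = "\<lambda>z. \<integral>\<^sup>+w. ennreal (exp (- (k * (dist z w)\<^sup>2 / 2)) * cmod (\<psi> w)) \<partial>\<mu>"
  have q: "?q \<ge> 0" using k A(1) by simp
  have Em: "(\<lambda>w. ennreal (exp (- (k * (dist z w)\<^sup>2 / 2)) * cmod (\<psi> w))) \<in> borel \<rightarrow>\<^sub>M borel" for z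
    using \<psi>b by measurable
  have pointwise: "ennreal (cmod (?T z)) \<le> ennreal ?q * ?I z" for z
  proof -
    have "ennreal (cmod (?T z)) \<le> (\<integral>\<^sup>+w. ennreal (cmod (toeplitz_integrand k a \<psi> z w)) \<partial>\<sigma>)"
      unfolding toeplitz_def by (rule integral_norm_bound_ennreal[OF int_T])
    also have "\<dots> \<le> (\<integral>\<^sup>+w. ennreal ?q *
        (ennreal (exp (- (k * (dist z w)\<^sup>2 / 2)) * cmod (\<psi> w)) * indicator K w) \<partial>\<sigma>)"
    proof (rule nn_integral_mono_AE)
      show "AE w in \<sigma>. ennreal (cmod (toeplitz_integrand k a \<psi> z w)) \<le> ennreal ?q *
        (ennreal (exp (- (k * (dist z w)\<^sup>2 / 2)) * cmod (\<psi> w)) * indicator K w)"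
        using A(2,3)
      proof eventually_elim
        case (elim w)
        show ?case
        proof (cases "w \<in> K")
          case True
          have "cmod (toeplitz_integrand k a \<psi> z w)
              = (k / pi) ^ ?N * exp (- (k * (dist z w)\<^sup>2 / 2)) * cmod (\<psi> w) * cmod (a w)"
            using k by (simp add: toeplitz_integrand_def norm_mult norm_bargmann_kernel)
          also have "\<dots> \<le> (k / pi) ^ ?N * exp (- (k * (dist z w)\<^sup>2 / 2)) * cmod (\<psi> w) * A"
            using elim(1) k by (intro mult_left_mono) simp_all
          also have "\<dots> = ?q * (exp (- (k * (dist z w)\<^sup>2 / 2)) * cmod (\<psi> w))"
            by (simp only: mult_ac)
          finally have "ennreal (cmod (toeplitz_integrand k a \<psi> z w))
              \<le> ennreal (?q * (exp (- (k * (dist z w)\<^sup>2 / 2)) * cmod (\<psi> w)))"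
            by (rule ennreal_leI)
          then show ?thesis using True q by (simp add: ennreal_mult)
        next
          case False
          then show ?thesis using elim(2) by (simp add: toeplitz_integrand_def)
        qed
      qed
    qed
    also have "\<dots> = ennreal ?q *
        (\<integral>\<^sup>+w. (ennreal (exp (- (k * (dist z w)\<^sup>2 / 2)) * cmod (\<psi> w)) * indicator K w) \<partial>\<sigma>)"
      by (intro nn_integral_cmult borel_measurable_times_ennreal measurable_compose[OF id Em]
          borel_measurable_indicator K)
    also have "\<dots> = ennreal ?q * ?I z"
      by (simp only: nn\<mu>[OF Em])
    finally show ?thesis .
  qed
  have int\<psi>: "integrable lborel (\<lambda>z. (cmod (\<psi> z))\<^sup>2)"
    using \<psi> unfolding bargmann_space_def by simp
  then have nn\<psi>: "(\<integral>\<^sup>+z. ennreal ((cmod (\<psi> z))\<^sup>2) \<partial>lborel) = ennreal ((L2_norm \<psi>)\<^sup>2)"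
    unfolding L2_norm_def by (subst nn_integral_eq_integral) (simp_all add: real_sqrt_pow2 integral_nonneg_AE)
  have Im: "(\<lambda>z. (?I z)\<^sup>2) \<in> borel_measurable lborel"
  proof -
    interpret sigma_finite_measure \<mu> by (rule sf)
    note [measurable_cong] = sets\<mu>
    note [measurable] = \<psi>b
    show ?thesis by measurable
  qed
  define c where "c = exp 1 * shell_sum d * shell_sum (2 * ?N) * C\<^sup>2 * k powr (- real d)"
  have c: "c \<ge> 0" unfolding c_def using shell_sum_nonneg[of d] shell_sum_nonneg[of "2 * ?N"] by simp
  have nnT: "(\<integral>\<^sup>+z. ennreal ((cmod (?T z))\<^sup>2) \<partial>lborel) \<le> ennreal (?q\<^sup>2 * c * (L2_norm \<psi>)\<^sup>2)"
  proof -
    have "(\<integral>\<^sup>+z. ennreal ((cmod (?T z))\<^sup>2) \<partial>lborel) \<le> (\<integral>\<^sup>+z. ennreal (?q\<^sup>2) * (?I z)\<^sup>2 \<partial>lborel)"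
    proof (rule nn_integral_mono)
      fix z
      have "(ennreal (cmod (?T z)))\<^sup>2 \<le> (ennreal ?q * ?I z)\<^sup>2"
        by (rule power_mono[OF pointwise]) simp
      then show "ennreal ((cmod (?T z))\<^sup>2) \<le> ennreal (?q\<^sup>2) * (?I z)\<^sup>2"
        using q by (simp only: power_mult_distrib[of "ennreal _"] ennreal_power norm_ge_zero)
    qed
    also have "\<dots> = ennreal (?q\<^sup>2) * (\<integral>\<^sup>+z. (?I z)\<^sup>2 \<partial>lborel)"
      by (rule nn_integral_cmult[OF Im])
    also have "\<dots> \<le> ennreal (?q\<^sup>2) * (ennreal c * (\<integral>\<^sup>+z. ennreal ((cmod (\<psi> z))\<^sup>2) \<partial>lborel))"
      unfolding c_def
      by (intro mult_left_mono gaussian_smoothing_bound[OF sf sets\<mu> C k growth\<mu> \<psi>]) simp_all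
    also have "\<dots> = ennreal (?q\<^sup>2 * c * (L2_norm \<psi>)\<^sup>2)"
      unfolding nn\<psi> using c by (simp only: ennreal_mult[symmetric] zero_le_power2 mult_nonneg_nonneg mult.assoc)
    finally show ?thesis .
  qed
  have intT: "integrable lborel (\<lambda>z. (cmod (?T z))\<^sup>2)"
    by (rule integrableI_bounded) (use nnT in \<open>simp_all add: le_less_trans[OF _ ennreal_less_top]\<close>)
  show "?T \<in> bargmann_space k"
    unfolding bargmann_space_def
    using \<open>entire F\<close> T_F intT by (auto simp: fun_eq_iff intro!: exI[of _ F])
  have "ennreal ((L2_norm ?T)\<^sup>2) \<le> ennreal (?q\<^sup>2 * c * (L2_norm \<psi>)\<^sup>2)"
    using nnT nn_integral_eq_integral[OF intT] unfolding L2_norm_def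
    by (simp add: real_sqrt_pow2 integral_nonneg_AE)
  then have "(L2_norm ?T)\<^sup>2 \<le> ?q\<^sup>2 * c * (L2_norm \<psi>)\<^sup>2"
    using c by (subst (asm) ennreal_le_iff) simp_all
  then have "sqrt ((L2_norm ?T)\<^sup>2) \<le> sqrt (?q\<^sup>2 * c * (L2_norm \<psi>)\<^sup>2)"
    by (rule real_sqrt_le_mono)
  moreover have L2pos: "L2_norm f \<ge> 0" for f :: "complex ^ 'n \<Rightarrow> complex"
    unfolding L2_norm_def by (simp add: integral_nonneg_AE)
  ultimately have "L2_norm ?T \<le> ?q * sqrt c * L2_norm \<psi>"
    using q by (simp only: real_sqrt_mult real_sqrt_abs abs_of_nonneg)
  also have "sqrt c = sqrt (exp 1 * shell_sum d * shell_sum (2 * ?N)) * C * k powr (- (real d / 2))"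
  proof -
    have "sqrt (k powr (- real d)) = k powr (- (real d / 2))"
      using k by (simp add: powr_half_sqrt[symmetric] powr_powr)
    then show ?thesis
      unfolding c_def using C by (simp only: real_sqrt_mult real_sqrt_abs abs_of_nonneg)
  qed
  also have "?q * (sqrt (exp 1 * shell_sum d * shell_sum (2 * ?N)) * C * k powr (- (real d / 2))) * L2_norm \<psi>
    = sqrt (exp 1 * shell_sum d * shell_sum (2 * ?N)) * C / pi ^ ?N * A
        * (k ^ ?N * k powr (- (real d / 2))) * L2_norm \<psi>"
    by (simp add: power_divide)
  also have "k ^ ?N * k powr (- (real d / 2)) = k powr (real ?N - real d / 2)"
    using k by (simp add: powr_realpow[symmetric] flip: powr_add)
  finally show "L2_norm ?T \<le> sqrt (exp 1 * shell_sum d * shell_sum (2 * ?N)) * C / pi ^ ?N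
         * A * k powr (real ?N - real d / 2) * L2_norm \<psi>" .
qed



text \<open>The open sets on which \<open>a\<close> vanishes almost everywhere may be uncountably many; by the Lindelof
property countably many of them have the same union, and a countable union of null sets is null.\<close>

lemma AE_zero_outside_ess_support:
  fixes M :: "'a::second_countable_topology measure"
  shows "AE x in M. x \<notin> ess_support M a \<longrightarrow> a x = 0"
proof -
  let ?\<F> = "{U. open U \<and> (AE y in M. y \<in> U \<longrightarrow> a y = 0)}"
  obtain \<F>' where \<F>': "\<F>' \<subseteq> ?\<F>" "countable \<F>'" "\<Union>\<F>' = \<Union>?\<F>"
    by (rule Lindelof[of ?\<F>]) simp_all
  have "AE y in M. \<forall>U\<in>\<F>'. y \<in> U \<longrightarrow> a y = 0"
    using \<F>'(1) by (subst AE_ball_countable[OF \<F>'(2)]) blast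
  with AE_space show ?thesis
  proof eventually_elim
    case (elim x)
    show ?case
    proof
      assume "x \<notin> ess_support M a"
      then have "x \<in> \<Union>?\<F>" using elim(1) by (auto simp: ess_support_def)
      then have "x \<in> \<Union>\<F>'" unfolding \<F>'(3) .
      then show "a x = 0" using elim(2) by blast
    qed
  qed
qed

theorem theorem1p3:
  fixes \<Gamma> :: "(complex ^ 'n) set" and \<sigma> :: "(complex ^ 'n) measure"
    and a :: "complex ^ 'n \<Rightarrow> complex" and d :: nat
  assumes "d \<le> 2 * CARD('n)"
    and "smooth_submanifold d \<Gamma>"
    and "riemannian_volume d \<Gamma> \<sigma>"
    and "a \<in> Linf \<sigma>"
    and "compact (ess_support \<sigma> a)"
  shows "\<exists>C::real. C > 0 \<and> (\<forall>k::real. k > 0 \<longrightarrow>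
           (\<forall>\<psi>\<in>bargmann_space k.
              (\<forall>z. integrable \<sigma> (toeplitz_integrand k a \<psi> z)) \<and>
              toeplitz k \<sigma> a \<psi> \<in> bargmann_space k) \<and>
           op_norm_on (bargmann_space k) (toeplitz k \<sigma> a)
             \<le> ennreal C * Linf_norm \<sigma> a * ennreal (k powr (real CARD('n) - real d / 2)))"
proof -
  define K where "K = ess_support \<sigma> a"
  have sets\<sigma>: "sets \<sigma> = sets (restrict_space borel \<Gamma>)"
    using assms(3) unfolding riemannian_volume_def by (rule conjunct1)
  have space\<sigma>: "space \<sigma> = \<Gamma>"
    using sets_eq_imp_space_eq[OF sets\<sigma>] by (simp add: space_restrict_space)
  have K: "compact K" "K \<subseteq> \<Gamma>"
    using assms(5) space\<sigma> by (auto simp: K_def ess_support_def)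
  have "K = \<Gamma> \<inter> K" using K(2) by (rule Int_absorb1[symmetric])
  then have K\<sigma>: "K \<in> sets \<sigma>"
    unfolding sets\<sigma> sets_restrict_space by (rule image_eqI) (rule borel_compact[OF K(1)])
  have id: "(\<lambda>w. w) \<in> \<sigma> \<rightarrow>\<^sub>M borel"
    unfolding measurable_cong_sets[OF sets\<sigma> refl] by (rule measurable_restrict_space1) simp
  obtain C where C: "C \<ge> 0"
    and growth: "\<And>z r. r > 0 \<Longrightarrow> emeasure \<sigma> (K \<inter> cball z r) \<le> ennreal (C * r ^ d)"
    using compact_submanifold_growth[OF assms(2,3) K] by blast
  have a: "a \<in> borel_measurable \<sigma>" and "Linf_norm \<sigma> a < \<infinity>"
    using assms(4) by (simp_all add: Linf_def)
  then obtain A where A: "Linf_norm \<sigma> a = ennreal A" "A \<ge> 0"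
    by (cases "Linf_norm \<sigma> a") auto
  have "AE w in \<sigma>. ennreal (cmod (a w)) \<le> ennreal A"
    using esssup_AE[of "\<lambda>w. ennreal (cmod (a w))" \<sigma>] A(1) by (simp add: Linf_norm_def)
  then have aA: "AE w in \<sigma>. cmod (a w) \<le> A"
    by eventually_elim (use A(2) in simp)
  have aK: "AE w in \<sigma>. w \<notin> K \<longrightarrow> a w = 0"
    unfolding K_def by (rule AE_zero_outside_ess_support)
  define c where "c = sqrt (exp 1 * shell_sum d * shell_sum (2 * CARD('n))) * C / pi ^ CARD('n)"
  have c: "c \<ge> 0"
    unfolding c_def using C shell_sum_nonneg[of d] shell_sum_nonneg[of "2 * CARD('n)"] by simp
  note bound = toeplitz_bound[OF id K(1) K\<sigma> C growth a A(2) aA aK, folded c_def]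
  have norm: "op_norm_on (bargmann_space k) (toeplitz k \<sigma> a)
      \<le> ennreal (c + 1) * Linf_norm \<sigma> a * ennreal (k powr (real CARD('n) - real d / 2))"
    if k: "k > 0" for k
    unfolding op_norm_on_def
  proof (rule SUP_least)
    fix \<psi> :: "complex ^ 'n \<Rightarrow> complex"
    assume "\<psi> \<in> {\<psi> \<in> bargmann_space k. L2_norm \<psi> \<le> 1}"
    then have \<psi>: "\<psi> \<in> bargmann_space k" "L2_norm \<psi> \<le> 1" by auto
    let ?p = "k powr (real CARD('n) - real d / 2)"
    have "L2_norm (toeplitz k \<sigma> a \<psi>) \<le> c * A * ?p * L2_norm \<psi>"
      by (rule bound(3)[OF _ k \<psi>(1)])
    also have "\<dots> \<le> c * A * ?p * 1"
      using c A(2) \<psi>(2) by (intro mult_left_mono) simp_all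
    also have "\<dots> \<le> (c + 1) * A * ?p * 1"
      using A(2) by (intro mult_right_mono) simp_all
    finally have "ennreal (L2_norm (toeplitz k \<sigma> a \<psi>)) \<le> ennreal ((c + 1) * A * ?p * 1)"
      by (rule ennreal_leI)
    also have "\<dots> = ennreal (c + 1) * Linf_norm \<sigma> a * ennreal ?p"
      using c A by (simp add: ennreal_mult)
    finally show "ennreal (L2_norm (toeplitz k \<sigma> a \<psi>))
      \<le> ennreal (c + 1) * Linf_norm \<sigma> a * ennreal ?p" .
  qed
  \<comment> \<open>\<open>c\<close> may be \<open>0\<close>; the added \<open>1\<close> makes the constant positive.\<close>
  show ?thesis
  proof (rule exI[of _ "c + 1"], intro conjI allI impI ballI)
    show "c + 1 > 0" using c by simp
    fix k :: real assume k: "k > 0"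
    show "op_norm_on (bargmann_space k) (toeplitz k \<sigma> a)
      \<le> ennreal (c + 1) * Linf_norm \<sigma> a * ennreal (k powr (real CARD('n) - real d / 2))"
      by (rule norm[OF k])
    fix \<psi> :: "complex ^ 'n \<Rightarrow> complex" assume \<psi>: "\<psi> \<in> bargmann_space k"
    show "integrable \<sigma> (toeplitz_integrand k a \<psi> z)" for z
      by (rule bound(1)[OF _ k \<psi>])
    show "toeplitz k \<sigma> a \<psi> \<in> bargmann_space k"
      by (rule bound(2)[OF _ k \<psi>])
  qed
qed

end
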